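(* Let $G$ be a three-dimensional unimodular Lie group and let $T$ be a left-invariant symmetric $(0,2)$ tensor field on $G$. Unless $T=0$, or $T$ has signature $(+,-,-)$ and $G=SO(3)$, there is at most one constant $c>0$ such that there exists a left-invariant Riemannian metric $g$ on $G$ solving $\mathrm{Ric}(g)=cT$.
   Context: $\mathrm{Ric}(g)$ is the Ricci curvature $(0,2)$-tensor of $g$. Three-dimensional unimodular Lie groups are identified through their Lie algebras: the Lie algebra $\mathfrak g$ of $G$ has a basis $V_1,V_2,V_3$ with $[V_i,V_j]=\sum_k\epsilon_{ijk}\lambda_kV_k$ ($\epsilon_{ijk}$ the Levi-Civita symbol), where $(\lambda_1,\lambda_2,\lambda_3)$ is exactly one of $(2,2,2)$, $(2,2,-2)$, $(2,2,0)$, $(2,-2,0)$, $(2,0,0)$, $(0,0,0)$, and the corresponding groups are named $SO(3)$, $SL(2)$, $E(2)$, $E(1,1)$, $H_3$, $\mathbb R^3$. Thus "$G=SO(3)$" means that the normalized structure constants are $(2,2,2)$, i.e. $\mathfrak g\cong\mathfrak{so}(3)$. "$T$ has signature $(+,-,-)$" means that the symmetric bilinear form on $\mathfrak g$ defined by $T$ is nondegenerate with one positive and two negative squares. *)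

theory Defs
  imports "HOL-Analysis.Analysis"
begin

text \<open>
  A left-invariant tensor field on a Lie group is determined by its value on the Lie algebra, and
  left-invariant vector fields are closed under the bracket and under the Levi-Civita connection
  of a left-invariant metric. Everything is therefore expressed on the Lie algebra, which is a
  real vector space with a Lie bracket; left-invariant metrics are the inner products on it.
\<close>

definition is_basis :: "'v::real_vector set \<Rightarrow> bool" where
  "is_basis B \<longleftrightarrow> independent B \<and> span B = UNIV"

text \<open>
  The trace of an endomorphism of an abstract finite-dimensional space; the choice of the basis
  is immaterial, see \<open>lin_trace_basis\<close> below.
\<close>

definition lin_trace :: "('v::real_vector \<Rightarrow> 'v) \<Rightarrow> real" where
  "lin_trace f = (let B = (SOME B. is_basis B) in \<Sum>b\<in>B. representation B (f b) b)"


subsection \<open>Lie algebras\<close>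

definition lie_bracket :: "('v::real_vector \<Rightarrow> 'v \<Rightarrow> 'v) \<Rightarrow> bool" where
  "lie_bracket br \<longleftrightarrow> bilinear br \<and> (\<forall>x. br x x = 0) \<and>
     (\<forall>x y z. br x (br y z) + br y (br z x) + br z (br x y) = 0)"

text \<open>
  A connected Lie group is unimodular iff all adjoint endomorphisms of its Lie algebra are
  traceless.
\<close>

definition unimodular :: "('v::real_vector \<Rightarrow> 'v \<Rightarrow> 'v) \<Rightarrow> bool" where
  "unimodular br \<longleftrightarrow> (\<forall>x. lin_trace (br x) = 0)"

text \<open>
  \<open>[V\<^sub>i, V\<^sub>j] = \<Sum>\<^sub>k \<epsilon>\<^sub>i\<^sub>j\<^sub>k \<lambda>\<^sub>k V\<^sub>k\<close>; the brackets not listed follow by antisymmetry.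
\<close>

definition has_structure_constants ::
    "('v::real_vector \<Rightarrow> 'v \<Rightarrow> 'v) \<Rightarrow> real \<Rightarrow> real \<Rightarrow> real \<Rightarrow> bool" where
  "has_structure_constants br l1 l2 l3 \<longleftrightarrow>
     (\<exists>V1 V2 V3. distinct [V1, V2, V3] \<and> is_basis {V1, V2, V3} \<and>
        br V1 V2 = l3 *\<^sub>R V3 \<and> br V2 V3 = l1 *\<^sub>R V1 \<and> br V3 V1 = l2 *\<^sub>R V2)"

definition is_SO3 :: "('v::real_vector \<Rightarrow> 'v \<Rightarrow> 'v) \<Rightarrow> bool" where
  "is_SO3 br \<longleftrightarrow> has_structure_constants br 2 2 2"


subsection \<open>Symmetric bilinear forms\<close>

definition symmetric_form :: "('v::real_vector \<Rightarrow> 'v \<Rightarrow> real) \<Rightarrow> bool" where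
  "symmetric_form T \<longleftrightarrow> bilinear T \<and> (\<forall>x y. T x y = T y x)"

definition metric_form :: "('v::real_vector \<Rightarrow> 'v \<Rightarrow> real) \<Rightarrow> bool" where
  "metric_form g \<longleftrightarrow> symmetric_form g \<and> (\<forall>x. x \<noteq> 0 \<longrightarrow> g x x > 0)"

text \<open>
  Signature \<open>(+,-,-)\<close> of a form on a three-dimensional space: one positive and two negative
  squares in a diagonalizing basis.
\<close>

definition signature_pmm :: "('v::real_vector \<Rightarrow> 'v \<Rightarrow> real) \<Rightarrow> bool" where
  "signature_pmm T \<longleftrightarrow>
     (\<exists>w1 w2 w3. distinct [w1, w2, w3] \<and> is_basis {w1, w2, w3} \<and>
        T w1 w2 = 0 \<and> T w1 w3 = 0 \<and> T w2 w3 = 0 \<and>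
        T w1 w1 > 0 \<and> T w2 w2 < 0 \<and> T w3 w3 < 0)"


subsection \<open>Curvature of a left-invariant metric\<close>

text \<open>
  \<open>D x y\<close> is \<open>\<nabla>\<^sub>x y\<close> for left-invariant fields. The derivative of the constant function \<open>g y z\<close>
  vanishes, so metric compatibility says that \<open>D x\<close> is skew.
\<close>

definition is_levi_civita ::
    "('v::real_vector \<Rightarrow> 'v \<Rightarrow> 'v) \<Rightarrow> ('v \<Rightarrow> 'v \<Rightarrow> real) \<Rightarrow> ('v \<Rightarrow> 'v \<Rightarrow> 'v) \<Rightarrow> bool" where
  "is_levi_civita br g D \<longleftrightarrow> bilinear D \<and>
     (\<forall>x y. D x y - D y x = br x y) \<and>
     (\<forall>x y z. g (D x y) z + g y (D x z) = 0)"

definition levi_civita ::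
    "('v::real_vector \<Rightarrow> 'v \<Rightarrow> 'v) \<Rightarrow> ('v \<Rightarrow> 'v \<Rightarrow> real) \<Rightarrow> 'v \<Rightarrow> 'v \<Rightarrow> 'v" where
  "levi_civita br g = (THE D. is_levi_civita br g D)"

definition riemann ::
    "('v::real_vector \<Rightarrow> 'v \<Rightarrow> 'v) \<Rightarrow> ('v \<Rightarrow> 'v \<Rightarrow> real) \<Rightarrow> 'v \<Rightarrow> 'v \<Rightarrow> 'v \<Rightarrow> 'v" where
  "riemann br g x y z = (let D = levi_civita br g in
     D x (D y z) - D y (D x z) - D (br x y) z)"

definition Ric :: "('v::real_vector \<Rightarrow> 'v \<Rightarrow> 'v) \<Rightarrow> ('v \<Rightarrow> 'v \<Rightarrow> real) \<Rightarrow> 'v \<Rightarrow> 'v \<Rightarrow> real" where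
  "Ric br g y z = lin_trace (\<lambda>x. riemann br g x y z)"


subsection \<open>The choices above are well defined\<close>

lemma ex_is_basis: "\<exists>B::'v::real_vector set. is_basis B"
  unfolding is_basis_def
  using real_vector.independent_extend_basis[OF real_vector.independent_empty]
    real_vector.span_extend_basis[OF real_vector.independent_empty] by blast

lemma finite_is_basis:
  assumes "dim (UNIV :: 'v::real_vector set) \<noteq> 0" "is_basis (B :: 'v set)"
  shows "finite B" "card B = dim (UNIV :: 'v set)"
proof -
  show c: "card B = dim (UNIV :: 'v set)"
    using assms(2) unfolding is_basis_def
    by (metis real_vector.dim_span_eq_card_independent)
  show "finite B"
    using c assms(1) card.infinite by force
qed

lemma representation_expand:
  assumes "is_basis B" "finite B"
  shows "(\<Sum>b\<in>B. representation B v b *\<^sub>R b) = v"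
  using assms real_vector.sum_representation_eq[of B v B] unfolding is_basis_def by auto

lemma lin_trace_basis:
  fixes f :: "'v::real_vector \<Rightarrow> 'v"
  assumes d: "dim (UNIV :: 'v set) \<noteq> 0" and f: "linear f" and C: "is_basis C"
  shows "lin_trace f = (\<Sum>c\<in>C. representation C (f c) c)"
proof -
  define B :: "'v set" where "B = (SOME B. is_basis B)"
  have B: "is_basis B"
    unfolding B_def using ex_is_basis by (rule someI_ex)
  note fin = finite_is_basis(1)[OF d B] finite_is_basis(1)[OF d C]
  have exp: "representation B' (f v) b = (\<Sum>c\<in>C'. representation C' v c * representation B' (f c) b)"
    if "is_basis B'" "is_basis C'" for B' C' :: "'v set" and v b
  proof -
    note fC = finite_is_basis(1)[OF d that(2)]
    have "f v = (\<Sum>c\<in>C'. representation C' v c *\<^sub>R f c)"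
      by (subst representation_expand[OF that(2) fC, of v, symmetric])
        (simp add: linear_sum[OF f] linear_scale[OF f])
    then show ?thesis
      using that unfolding is_basis_def
      by (simp add: real_vector.representation_sum real_vector.representation_scale)
  qed
  have exp2: "representation C (f c) c = (\<Sum>b\<in>B. representation B (f c) b * representation C b c)" for c
  proof -
    have "f c = (\<Sum>b\<in>B. representation B (f c) b *\<^sub>R b)"
      using representation_expand[OF B fin(1)] by simp
    then have "representation C (f c) c = representation C (\<Sum>b\<in>B. representation B (f c) b *\<^sub>R b) c"
      by simp
    then show ?thesis
      using C unfolding is_basis_def
      by (simp add: real_vector.representation_sum real_vector.representation_scale)
  qed
  have "(\<Sum>c\<in>C. representation C (f c) c)
      = (\<Sum>c\<in>C. \<Sum>b\<in>B. representation B (f c) b * representation C b c)"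
    by (simp add: exp2)
  also have "\<dots> = (\<Sum>b\<in>B. \<Sum>c\<in>C. representation C b c * representation B (f c) b)"
    by (subst sum.swap) (simp add: mult.commute)
  also have "\<dots> = (\<Sum>b\<in>B. representation B (f b) b)"
    by (simp add: exp[OF B C, symmetric])
  finally show ?thesis
    by (simp add: lin_trace_def B_def Let_def)
qed

lemma metric_form_riesz_span:
  fixes g :: "'v::real_vector \<Rightarrow> 'v \<Rightarrow> real"
  assumes g: "metric_form g" and S: "finite S"
  shows "linear \<phi> \<Longrightarrow> \<exists>w\<in>span S. \<forall>z\<in>span S. g w z = \<phi> z"
  using S
proof (induction S arbitrary: \<phi> rule: finite_induct)
  case empty
  then show ?case
    using g by (auto simp: metric_form_def symmetric_form_def linear_0 bilinear_lzero)
next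
  case (insert a S)
  have bl: "bilinear g" and sym: "g x y = g y x" and pos: "x \<noteq> 0 \<Longrightarrow> g x x > 0" for x y
    using g by (auto simp: metric_form_def symmetric_form_def)
  note bs = bilinear_ladd[OF bl] bilinear_radd[OF bl] bilinear_lsub[OF bl] bilinear_rsub[OF bl]
    bilinear_lmul[OF bl] bilinear_rmul[OF bl]
  have "linear (g a)"
    using bl by (simp add: bilinear_def)
  from insert.IH[OF this] obtain p where p: "p \<in> span S" "\<And>z. z \<in> span S \<Longrightarrow> g p z = g a z"
    by blast
  from insert.IH[OF insert.prems] obtain w0
    where w0: "w0 \<in> span S" "\<And>z. z \<in> span S \<Longrightarrow> g w0 z = \<phi> z" by blast
  define u where "u = a - p"
  have u: "g u z = 0" if "z \<in> span S" for z
    using p(2)[OF that] by (simp add: u_def bs)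
  show ?case
  proof (cases "u = 0")
    case True
    then have "span (insert a S) = span S"
      using p(1) by (simp add: u_def span_redundant)
    then show ?thesis using w0 by auto
  next
    case False
    define w where "w = w0 + (\<phi> u / g u u) *\<^sub>R u"
    have sub: "span S \<subseteq> span (insert a S)"
      by (simp add: span_mono subset_insertI)
    have uin: "u \<in> span (insert a S)"
      unfolding u_def using p(1) sub by (auto intro: span_diff span_base)
    have win: "w \<in> span (insert a S)"
      unfolding w_def using w0(1) sub uin by (auto intro: span_add span_scale)
    have "g w z = \<phi> z" if zin: "z \<in> span (insert a S)" for z
    proof -
      obtain k where k: "z - k *\<^sub>R a \<in> span S"
        using zin unfolding span_insert by blast
      define y where "y = z - k *\<^sub>R a + k *\<^sub>R p"
      have y: "y \<in> span S"
        unfolding y_def using k p(1) by (intro span_add span_scale)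
      have z: "z = y + k *\<^sub>R u"
        by (simp add: y_def u_def algebra_simps)
      have "g w0 u = 0"
        using u[OF w0(1)] sym by simp
      then have "g w z = \<phi> y + k * \<phi> u"
        using w0(2)[OF y] u[OF y] pos[OF False] by (simp add: w_def z bs)
      then show ?thesis
        by (simp add: z linear_add[OF insert.prems] linear_scale[OF insert.prems])
    qed
    then show ?thesis using win by blast
  qed
qed

lemma levi_civita_koszul:
  assumes g: "metric_form g" and D: "is_levi_civita br g D"
  shows "2 * g (D x y) z = g (br x y) z - g (br y z) x + g (br z x) y"
proof -
  have bl: "bilinear g" and sym: "g x y = g y x" for x y
    using g by (auto simp: metric_form_def symmetric_form_def)
  have br: "br x y = D x y - D y x" for x y
    using D by (simp add: is_levi_civita_def)
  have sk: "g (D x y) z = - g (D x z) y" for x y z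
  proof -
    have "g (D x y) z + g y (D x z) = 0"
      using D by (simp add: is_levi_civita_def)
    then show ?thesis
      unfolding sym[of y "D x z"] by linarith
  qed
  show ?thesis
    unfolding br bilinear_lsub[OF bl]
    using sk[of x y z] sk[of y x z] sk[of z x y] by linarith
qed

lemma metric_form_eqI:
  assumes "metric_form g" "\<And>z. g u z = g v z"
  shows "u = v"
proof -
  have "bilinear g" using assms(1) by (simp add: metric_form_def symmetric_form_def)
  then have "g (u - v) (u - v) = 0"
    by (simp add: bilinear_lsub assms(2))
  then show ?thesis
    using assms(1) unfolding metric_form_def by (metis less_irrefl right_minus_eq)
qed

lemma levi_civita_unique:
  assumes "dim (UNIV :: 'v::real_vector set) \<noteq> 0"
    and br: "lie_bracket (br :: 'v \<Rightarrow> 'v \<Rightarrow> 'v)" and g: "metric_form g"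
  shows "\<exists>!D. is_levi_civita br g D"
proof (rule ex_ex1I)
  fix D D' assume "is_levi_civita br g D" "is_levi_civita br g D'"
  from this[THEN levi_civita_koszul[OF g]] have "g (D x y) z = g (D' x y) z" for x y z
    by (smt (verit))
  then show "D = D'"
    using metric_form_eqI[OF g] by (intro ext) blast
next
  obtain B :: "'v set" where "is_basis B" using ex_is_basis by blast
  then have fB: "finite B" and sB: "span B = UNIV"
    using finite_is_basis[OF assms(1)] by (auto simp: is_basis_def)
  have bl: "bilinear g" and sym: "g x y = g y x" for x y
    using g by (auto simp: metric_form_def symmetric_form_def)
  have bb: "bilinear br" and alt: "br x x = 0" for x
    using br by (auto simp: lie_bracket_def)
  have anti: "br x y = - br y x" for x y
  proof -
    have "br (x + y) (x + y) = br x y + br y x"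
      unfolding bilinear_ladd[OF bb] bilinear_radd[OF bb] by (simp add: alt)
    then show ?thesis unfolding alt by (simp add: eq_neg_iff_add_eq_0)
  qed
  note bs = bilinear_ladd[OF bl] bilinear_radd[OF bl] bilinear_lsub[OF bl] bilinear_rsub[OF bl]
    bilinear_lmul[OF bl] bilinear_rmul[OF bl] bilinear_ladd[OF bb] bilinear_radd[OF bb]
    bilinear_lmul[OF bb] bilinear_rmul[OF bb]
  define k where "k x y z = (g (br x y) z - g (br y z) x + g (br z x) y) / 2" for x y z
  have "linear (k x y)" for x y
    by (rule linearI) (simp_all add: k_def bs field_simps)
  then have "\<exists>w. \<forall>z. g w z = k x y z" for x y
    using metric_form_riesz_span[OF g fB] sB by (metis UNIV_I)
  then obtain D where D: "g (D x y) z = k x y z" for x y z by metis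
  have "is_levi_civita br g D"
    unfolding is_levi_civita_def bilinear_def
  proof (intro conjI allI linearI)
    fix x y z :: 'v and c :: real
    show "D x (y + z) = D x y + D x z"
      by (rule metric_form_eqI[OF g]) (simp add: bs D, simp add: k_def bs field_simps)
    show "D (y + z) x = D y x + D z x"
      by (rule metric_form_eqI[OF g]) (simp add: bs D, simp add: k_def bs field_simps)
    show "D x (c *\<^sub>R y) = c *\<^sub>R D x y"
      by (rule metric_form_eqI[OF g]) (simp add: bs D, simp add: k_def bs field_simps)
    show "D (c *\<^sub>R y) x = c *\<^sub>R D y x"
      by (rule metric_form_eqI[OF g]) (simp add: bs D, simp add: k_def bs field_simps)
    show "D x y - D y x = br x y"
    proof (rule metric_form_eqI[OF g])
      fix z
      have "g (br y x) z = - g (br x y) z" "g (br z y) x = - g (br y z) x" "g (br x z) y = - g (br z x) y"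
        using anti[of y x] anti[of z y] anti[of x z] by (simp_all add: bilinear_lneg[OF bl])
      then show "g (D x y - D y x) z = g (br x y) z"
        by (simp add: bs D k_def field_simps)
    qed
    have "g (br x z) y = - g (br z x) y" "g (br z y) x = - g (br y z) x" "g (br y x) z = - g (br x y) z"
      using anti[of x z] anti[of z y] anti[of y x] by (simp_all add: bilinear_lneg[OF bl])
    then show "g (D x y) z + g y (D x z) = 0"
      by (simp add: sym[of y] D k_def field_simps)
  qed
  then show "\<exists>D. is_levi_civita br g D" by blast
qed

end

theory Submission
  imports Defs
begin

text \<open>
  Let \<open>g\<close> be a left-invariant metric. In three dimensions the metric turns the bracket into
  \<open>[x, y] = M (x \<times> y)\<close> with a linear map \<open>M\<close>, and unimodularity says that \<open>M\<close> is symmetric. An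
  oriented orthonormal eigenbasis of \<open>M\<close> is a frame with \<open>[e\<^sub>i, e\<^sub>j] = l\<^sub>k e\<^sub>k\<close> for cyclic
  \<open>i, j, k\<close>. Writing \<open>l\<^sub>i = m\<^sub>j + m\<^sub>k\<close>, the Ricci form is diagonal in this frame with entries
  \<open>2 m\<^sub>j m\<^sub>k\<close>, and the Killing form \<open>B\<close> is diagonal with entries \<open>- 2 l\<^sub>j l\<^sub>k\<close>. After this the metric
  is forgotten: a solution of \<open>Ric g = c T\<close> is remembered only as such a frame, a \<open>ricci_frame\<close>
  for \<open>c T\<close>.

  Let \<open>P = l\<^sub>1 l\<^sub>2 l\<^sub>3\<close>, \<open>t = \<Sum> l\<^sub>i T(e\<^sub>i, e\<^sub>i)\<close>, \<open>D = \<Prod> T(e\<^sub>i, e\<^sub>i)\<close> and \<open>q = 2 m\<^sub>1 m\<^sub>2 m\<^sub>3\<close>. Passing to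
  another frame that diagonalizes both the bracket and \<open>T\<close> multiplies \<open>P\<close> and \<open>t\<close> by the
  determinant of the change of frame and \<open>D\<close> by its square (\<open>milnor_frame_change\<close>), whereas
  \<open>2 P - c t = 2 q\<close> and \<open>2 q\<^sup>2 = c\<^sup>3 D\<close> hold identically. Eliminating \<open>q\<close> gives the equation
  \<open>(2 P - c t)\<^sup>2 = 2 c\<^sup>3 D\<close> for \<open>c\<close>, which up to a nonzero factor is the
  same for all solutions.

  If \<open>P = 0\<close> and \<open>D \<noteq> 0\<close>, it determines \<open>c\<close>. If \<open>P = 0 = D\<close>, then \<open>T \<noteq> 0\<close> forces \<open>c T = - B\<close>,
  which determines \<open>c\<close>. If \<open>P \<noteq> 0\<close>, put \<open>w = q / P\<close>, so that \<open>w = 1 - c \<theta>\<close> and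
  \<open>w\<^sup>2 = 4 c\<^sup>3 E\<close> with \<open>\<theta>\<close> and \<open>E\<close> common to all solutions. In particular all solutions agree
  on whether \<open>w = 0\<close>. On each of the regions \<open>w = 0\<close>, \<open>w > 0\<close>, \<open>- 2 \<le> w < 0\<close> and \<open>w \<le> - 2\<close>
  there is at most one solution (\<open>scale_unique\<close>), and it remains to see
  that two solutions for the same \<open>T\<close> lie in the same region. For \<open>w < 0\<close> and all \<open>l\<^sub>i\<close> of the same
  sign, the group is \<open>SO(3)\<close> and \<open>T\<close> has signature \<open>(+,-,-)\<close>, which is excluded. If the signs are
  mixed, i.e. if \<open>B\<close> is indefinite, the regions are told apart by the pencil \<open>T + k B\<close>, \<open>k > 0\<close>:
  it is always indefinite for \<open>w > 0\<close>, has a nonzero negative semidefinite member for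
  \<open>- 2 < w < 0\<close> and a positive semidefinite one for \<open>w \<le> - 2\<close>, and these behaviours exclude
  each other.
\<close>

section \<open>Three-dimensional linear algebra\<close>

text \<open>
  An ordered version of \<^const>\<open>is_basis\<close>: matrix entries, traces and cyclic shifts need the vectors
  by position.
\<close>

definition basis3 :: "'v::real_vector \<Rightarrow> 'v \<Rightarrow> 'v \<Rightarrow> bool" where
  "basis3 a b c \<longleftrightarrow> distinct [a, b, c] \<and> is_basis {a, b, c}"

lemma basis3_expand:
  assumes "basis3 a b c"
  obtains x y z where "v = x *\<^sub>R a + y *\<^sub>R b + z *\<^sub>R c"
proof -
  have "v \<in> span {a, b, c}"
    using assms by (simp add: basis3_def is_basis_def)
  then obtain x y z where "v - x *\<^sub>R a - y *\<^sub>R b = z *\<^sub>R c"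
    by (auto simp: span_insert span_empty algebra_simps)
  then have "v = x *\<^sub>R a + y *\<^sub>R b + z *\<^sub>R c"
    by (simp add: algebra_simps)
  then show thesis by (rule that)
qed

lemma basis3_coeffs_zero:
  assumes "basis3 a b c" "x *\<^sub>R a + y *\<^sub>R b + z *\<^sub>R c = 0"
  shows "x = 0" "y = 0" "z = 0"
proof -
  have d: "a \<noteq> b" "a \<noteq> c" "b \<noteq> c" and i: "independent {a, b, c}"
    using assms(1) by (auto simp: basis3_def is_basis_def)
  define u where "u v = (if v = a then x else if v = b then y else z)" for v
  have "(\<Sum>v\<in>{a, b, c}. u v *\<^sub>R v) = x *\<^sub>R a + (y *\<^sub>R b + z *\<^sub>R c)"
    using d by (simp add: u_def)
  also have "\<dots> = 0"
    using assms(2) by (simp add: add.assoc)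
  finally have s: "(\<Sum>v\<in>{a, b, c}. u v *\<^sub>R v) = 0" .
  have "u v = 0" if "v \<in> {a, b, c}" for v
    by (rule real_vector.independentD[OF i _ _ s that]) auto
  from this[of a] this[of b] this[of c] show "x = 0" "y = 0" "z = 0"
    using d by (simp_all add: u_def split: if_splits)
qed

lemma basis3I:
  assumes zero: "\<And>x y z. x *\<^sub>R a + y *\<^sub>R b + z *\<^sub>R c = 0 \<Longrightarrow> x = 0 \<and> y = 0 \<and> z = 0"
    and expand: "\<And>v. \<exists>x y z. v = x *\<^sub>R a + y *\<^sub>R b + z *\<^sub>R c"
  shows "basis3 a b c"
proof -
  have ab: "a \<noteq> b" using zero[of 1 "-1" 0] by auto
  have ac: "a \<noteq> c" using zero[of 1 0 "-1"] by auto
  have bc: "b \<noteq> c" using zero[of 0 1 "-1"] by auto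
  have "independent {a, b, c}"
  proof (rule real_vector.independent_if_scalars_zero)
    fix f v assume s: "(\<Sum>x\<in>{a, b, c}. f x *\<^sub>R x) = 0" and v: "v \<in> {a, b, c}"
    have "f a *\<^sub>R a + f b *\<^sub>R b + f c *\<^sub>R c = 0"
      using s ab ac bc by (simp add: add.assoc)
    then show "f v = 0" using zero v by auto
  qed simp
  moreover have "v \<in> span {a, b, c}" for v
  proof -
    obtain x y z where "v = x *\<^sub>R a + y *\<^sub>R b + z *\<^sub>R c" using expand by blast
    moreover have "a \<in> span {a, b, c}" "b \<in> span {a, b, c}" "c \<in> span {a, b, c}"
      by (simp_all add: span_base)
    ultimately show ?thesis by (simp add: span_add span_scale)
  qed
  ultimately show ?thesis
    using ab ac bc by (auto simp: basis3_def is_basis_def)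
qed

lemma basis3_rotate: "basis3 a b c \<Longrightarrow> basis3 b c a"
  by (auto simp: basis3_def insert_commute)

lemma basis3_scale:
  assumes "basis3 a b c" "r \<noteq> 0" "s \<noteq> 0" "t \<noteq> 0"
  shows "basis3 (r *\<^sub>R a) (s *\<^sub>R b) (t *\<^sub>R c)"
proof (rule basis3I)
  fix x y z assume "x *\<^sub>R r *\<^sub>R a + y *\<^sub>R s *\<^sub>R b + z *\<^sub>R t *\<^sub>R c = 0"
  then show "x = 0 \<and> y = 0 \<and> z = 0"
    using basis3_coeffs_zero[OF assms(1), of "x * r" "y * s" "z * t"] assms(2-4) by simp
next
  fix v
  obtain x y z where "v = x *\<^sub>R a + y *\<^sub>R b + z *\<^sub>R c"
    using basis3_expand[OF assms(1)] by blast
  then have "v = (x / r) *\<^sub>R r *\<^sub>R a + (y / s) *\<^sub>R s *\<^sub>R b + (z / t) *\<^sub>R t *\<^sub>R c"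
    using assms(2-4) by simp
  then show "\<exists>x y z. v = x *\<^sub>R r *\<^sub>R a + y *\<^sub>R s *\<^sub>R b + z *\<^sub>R t *\<^sub>R c" by blast
qed

lemma basis3_representation:
  assumes "basis3 a b c"
  shows "representation {a, b, c} (x *\<^sub>R a + y *\<^sub>R b + z *\<^sub>R c) a = x"
    and "representation {a, b, c} (x *\<^sub>R a + y *\<^sub>R b + z *\<^sub>R c) b = y"
    and "representation {a, b, c} (x *\<^sub>R a + y *\<^sub>R b + z *\<^sub>R c) c = z"
proof -
  have d: "a \<noteq> b" "a \<noteq> c" "b \<noteq> c" and i: "independent {a, b, c}" and s: "span {a, b, c} = UNIV"
    using assms by (auto simp: basis3_def is_basis_def)
  note r = real_vector.representation_add[OF i] real_vector.representation_scale[OF i]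
    real_vector.representation_basis[OF i]
  show "representation {a, b, c} (x *\<^sub>R a + y *\<^sub>R b + z *\<^sub>R c) a = x"
    "representation {a, b, c} (x *\<^sub>R a + y *\<^sub>R b + z *\<^sub>R c) b = y"
    "representation {a, b, c} (x *\<^sub>R a + y *\<^sub>R b + z *\<^sub>R c) c = z"
    using d s by (simp_all add: r)
qed

lemma lin_trace_basis3:
  fixes f :: "'v::real_vector \<Rightarrow> 'v"
  assumes d: "dim (UNIV :: 'v set) = 3" and f: "linear f" and B: "basis3 a b c"
    and "f a = a1 *\<^sub>R a + a2 *\<^sub>R b + a3 *\<^sub>R c"
    and "f b = b1 *\<^sub>R a + b2 *\<^sub>R b + b3 *\<^sub>R c"
    and "f c = c1 *\<^sub>R a + c2 *\<^sub>R b + c3 *\<^sub>R c"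
  shows "lin_trace f = a1 + b2 + c3"
proof -
  have n: "a \<noteq> b" "a \<noteq> c" "b \<noteq> c" and i: "is_basis {a, b, c}"
    using B by (auto simp: basis3_def)
  have "lin_trace f = (\<Sum>v\<in>{a, b, c}. representation {a, b, c} (f v) v)"
    using d by (intro lin_trace_basis[OF _ f i]) simp
  also have "\<dots> = a1 + b2 + c3"
    using n by (simp add: assms(4-6) basis3_representation[OF B])
  finally show ?thesis .
qed

text \<open>
  Subtracting from a vector outside the span its orthogonal projection, supplied by the Riesz
  representation of \<open>g x\<close> on the span, leaves a nonzero vector to be normalized.
\<close>

lemma ex_unit_orthogonal:
  fixes g :: "'v::real_vector \<Rightarrow> 'v \<Rightarrow> real"
  assumes g: "metric_form g" and S: "finite S" "span S \<noteq> UNIV"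
  obtains u where "g u u = 1" "\<And>s. s \<in> S \<Longrightarrow> g u s = 0"
proof -
  have bl: "bilinear g" and sym: "g x y = g y x" and pos: "x \<noteq> 0 \<Longrightarrow> g x x > 0" for x y
    using g by (auto simp: metric_form_def symmetric_form_def)
  note bs = bilinear_lsub[OF bl] bilinear_lmul[OF bl] bilinear_rmul[OF bl]
  obtain x where x: "x \<notin> span S" using S(2) by auto
  have "linear (g x)" using bl by (simp add: bilinear_def)
  from metric_form_riesz_span[OF g S(1) this]
  obtain w where w: "w \<in> span S" "\<And>z. z \<in> span S \<Longrightarrow> g w z = g x z" by blast
  define u where "u = x - w"
  have "u \<noteq> 0" using x w(1) by (auto simp: u_def)
  then have p: "g u u > 0" by (rule pos)
  show thesis
  proof
    show "g ((1 / sqrt (g u u)) *\<^sub>R u) ((1 / sqrt (g u u)) *\<^sub>R u) = 1"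
      using p by (simp add: bs)
    show "g ((1 / sqrt (g u u)) *\<^sub>R u) s = 0" if "s \<in> S" for s
      using w(2)[OF span_base[OF that]] by (simp add: bs u_def)
  qed
qed

definition orthonormal3 :: "('v::real_vector \<Rightarrow> 'v \<Rightarrow> real) \<Rightarrow> 'v \<Rightarrow> 'v \<Rightarrow> 'v \<Rightarrow> bool" where
  "orthonormal3 g a b c \<longleftrightarrow> g a a = 1 \<and> g b b = 1 \<and> g c c = 1 \<and> g a b = 0 \<and> g b c = 0 \<and> g c a = 0"

lemma orthonormal3_rotate: "orthonormal3 g a b c \<Longrightarrow> orthonormal3 g b c a"
  by (simp add: orthonormal3_def)

lemma ex_orthonormal3:
  fixes g :: "'v::real_vector \<Rightarrow> 'v \<Rightarrow> real"
  assumes d: "dim (UNIV :: 'v set) = 3" and g: "metric_form g"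
  obtains a b c where "orthonormal3 g a b c"
proof -
  have sym: "g x y = g y x" for x y
    using g by (auto simp: metric_form_def symmetric_form_def)
  have small: "span S \<noteq> UNIV" if "finite S" "card S \<le> 2" for S :: "'v set"
    using real_vector.dim_le_card[of UNIV S] that d by auto
  obtain a where a: "g a a = 1"
    using ex_unit_orthogonal[OF g _ small[of "{}"]] by auto
  obtain b where b: "g b b = 1" "g b a = 0"
    using ex_unit_orthogonal[OF g _ small[of "{a}"]] by auto
  have "card {a, b} \<le> 2" by (simp add: card_insert_if)
  then obtain c where c: "g c c = 1" "g c a = 0" "g c b = 0"
    using ex_unit_orthogonal[OF g _ small[of "{a, b}"], of thesis] by simp
  have "orthonormal3 g a b c"
    using a b c sym[of a b] sym[of b c] by (simp add: orthonormal3_def)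
  then show thesis by (rule that)
qed

text \<open>
  Independence follows by pairing with the three vectors. They span because the defect of a vector
  from its orthonormal expansion would be a fourth independent vector.
\<close>

lemma orthonormal3_imp_basis3:
  fixes g :: "'v::real_vector \<Rightarrow> 'v \<Rightarrow> real"
  assumes d: "dim (UNIV :: 'v set) = 3" and g: "metric_form g" and o: "orthonormal3 g a b c"
  shows "basis3 a b c"
    and "v = g v a *\<^sub>R a + g v b *\<^sub>R b + g v c *\<^sub>R c"
proof -
  have bl: "bilinear g" and sym: "g x y = g y x" for x y
    using g by (auto simp: metric_form_def symmetric_form_def)
  note bs = bilinear_ladd[OF bl] bilinear_lmul[OF bl] bilinear_lsub[OF bl] bilinear_lzero[OF bl]
  have o': "g a a = 1" "g b b = 1" "g c c = 1" "g a b = 0" "g b c = 0" "g c a = 0"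
    "g b a = 0" "g c b = 0" "g a c = 0"
    using o sym[of a b] sym[of b c] sym[of a c] by (simp_all add: orthonormal3_def)
  have zero: "x = 0 \<and> y = 0 \<and> z = 0" if "x *\<^sub>R a + y *\<^sub>R b + z *\<^sub>R c = 0" for x y z
    using arg_cong[OF that, of "\<lambda>u. g u a"] arg_cong[OF that, of "\<lambda>u. g u b"]
      arg_cong[OF that, of "\<lambda>u. g u c"] by (simp add: bs o')
  have expand: "v = g v a *\<^sub>R a + g v b *\<^sub>R b + g v c *\<^sub>R c" for v
  proof (rule ccontr)
    have n: "a \<noteq> b" "a \<noteq> c" "b \<noteq> c" using o' by auto
    have i: "independent {a, b, c}"
    proof (rule real_vector.independent_if_scalars_zero)
      fix f v assume s: "(\<Sum>x\<in>{a, b, c}. f x *\<^sub>R x) = 0" and v: "v \<in> {a, b, c}"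
      have "f a *\<^sub>R a + f b *\<^sub>R b + f c *\<^sub>R c = 0"
        using s n by (simp add: add.assoc)
      then show "f v = 0" using zero v by auto
    qed simp
    define u where "u = v - (g v a *\<^sub>R a + g v b *\<^sub>R b + g v c *\<^sub>R c)"
    assume "v \<noteq> g v a *\<^sub>R a + g v b *\<^sub>R b + g v c *\<^sub>R c"
    then have u0: "u \<noteq> 0" by (simp add: u_def)
    have uabc: "g u a = 0" "g u b = 0" "g u c = 0" by (simp_all add: u_def bs o')
    have "u \<notin> span {a, b, c}"
    proof
      assume "u \<in> span {a, b, c}"
      then obtain x y z where "u - x *\<^sub>R a - y *\<^sub>R b = z *\<^sub>R c"
        by (auto simp: span_insert span_empty algebra_simps)
      then have u: "u = x *\<^sub>R a + y *\<^sub>R b + z *\<^sub>R c" by (simp add: algebra_simps)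
      with uabc have "x = 0" "y = 0" "z = 0" by (simp_all add: bs o')
      with u u0 show False by simp
    qed
    with i have i4: "independent (insert u {a, b, c})" and "u \<notin> {a, b, c}"
      by (auto simp: real_vector.independent_insert span_base)
    then have "card (insert u {a, b, c}) = 4" using n by simp
    moreover obtain B :: "'v set" where B: "is_basis B" using ex_is_basis by blast
    then have "finite B" "card B = 3" using finite_is_basis[OF _ B] d by auto
    ultimately show False
      using real_vector.independent_span_bound[OF _ i4, of B] B by (simp add: is_basis_def)
  qed
  show "basis3 a b c" by (rule basis3I) (use zero expand in blast)+
  show "v = g v a *\<^sub>R a + g v b *\<^sub>R b + g v c *\<^sub>R c" by (rule expand)
qed

text \<open>
  Two applications give the eigenvectors of a symmetric form in dimension three: \<open>u\<close> maximizes
  the quadratic form on the unit vectors orthogonal to \<open>a\<close> (with \<open>a = 0\<close> there is no constraint), and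
  the first variation at the maximum vanishes.
\<close>

lemma ex_unit_critical:
  fixes b :: "'a::euclidean_space \<Rightarrow> 'a \<Rightarrow> real"
  assumes b: "bilinear b" and sym: "\<And>x y. b x y = b y x" and dim: "DIM('a) \<ge> 2"
  obtains u where "norm u = 1" "u \<bullet> a = 0" "\<And>x. x \<bullet> a = 0 \<Longrightarrow> x \<bullet> u = 0 \<Longrightarrow> b u x = 0"
proof -
  note bs = bilinear_ladd[OF b] bilinear_radd[OF b] bilinear_lmul[OF b] bilinear_rmul[OF b]
  define S where "S = sphere 0 1 \<inter> {x. a \<bullet> x = 0}"
  have S: "compact S"
    unfolding S_def by (intro compact_Int_closed compact_sphere closed_hyperplane)
  obtain y where y: "y \<noteq> 0" "a \<bullet> y = 0"
    using orthogonal_to_vector_exists[OF dim, of a] by (auto simp: orthogonal_def)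
  then have "(1 / norm y) *\<^sub>R y \<in> S" by (simp add: S_def)
  then have "S \<noteq> {}" by blast
  moreover have "continuous_on S (\<lambda>x. b x x)"
    using b unfolding bilinear_conv_bounded_bilinear
    by (rule bounded_bilinear.continuous_on) (auto intro: continuous_intros)
  ultimately obtain u where u: "u \<in> S" "\<And>x. x \<in> S \<Longrightarrow> b x x \<le> b u u"
    using continuous_attains_sup[OF S] by blast
  have uu: "norm u = 1" "a \<bullet> u = 0" using u(1) by (auto simp: S_def)
  have bound: "b x x \<le> b u u * (x \<bullet> x)" if "a \<bullet> x = 0" for x
  proof (cases "x = 0")
    case True
    then show ?thesis by (simp add: bilinear_lzero[OF b])
  next
    case False
    have "b ((1 / norm x) *\<^sub>R x) ((1 / norm x) *\<^sub>R x) \<le> b u u"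
      using False that by (intro u(2)) (simp add: S_def)
    then show ?thesis
      using False by (simp add: bs field_simps power2_norm_eq_inner[symmetric] power2_eq_square)
  qed
  have "b u x = 0" if x: "x \<bullet> a = 0" "x \<bullet> u = 0" for x
  proof (rule ccontr)
    define \<beta> K where "\<beta> = b u x" and "K = b x x - b u u * (x \<bullet> x)"
    assume "b u x \<noteq> 0"
    then have \<beta>: "\<beta> \<noteq> 0" by (simp add: \<beta>_def)
    have le: "2 * s * \<beta> + s\<^sup>2 * K \<le> 0" for s
    proof -
      have "a \<bullet> (u + s *\<^sub>R x) = 0"
        using uu x by (simp add: inner_add_right inner_commute)
      from bound[OF this] have "b (u + s *\<^sub>R x) (u + s *\<^sub>R x) \<le> b u u * (u \<bullet> u + s\<^sup>2 * (x \<bullet> x))"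
        using x(2)
        by (simp add: inner_add_left inner_add_right inner_commute power2_eq_square mult.assoc)
      then have "b (u + s *\<^sub>R x) (u + s *\<^sub>R x) \<le> b u u * (1 + s\<^sup>2 * (x \<bullet> x))"
        using uu(1) by (simp add: power2_norm_eq_inner[symmetric])
      then show ?thesis
        using sym[of x u] by (simp add: bs \<beta>_def K_def algebra_simps power2_eq_square)
    qed
    \<comment> \<open>The linear term wins for small \<open>s\<close> of the sign of \<open>\<beta>\<close>; \<open>s = \<beta> / n\<close> is small enough.\<close>
    define n where "n = \<bar>K\<bar> + 1"
    have n: "n > 0" "K > - n" by (simp_all add: n_def)
    have "2 * (\<beta> / n) * \<beta> + (\<beta> / n)\<^sup>2 * K = (\<beta>\<^sup>2 / n\<^sup>2) * (2 * n + K)"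
      using n(1) by (simp add: field_simps power2_eq_square)
    moreover have "(\<beta>\<^sup>2 / n\<^sup>2) * (2 * n + K) > 0"
      using \<beta> n by (intro mult_pos_pos) auto
    ultimately show False using le[of "\<beta> / n"] by linarith
  qed
  with uu show thesis by (intro that[of u]) (simp_all add: inner_commute[of u a])
qed

lemma ex_diagonalizing_frame:
  fixes b :: "real^3 \<Rightarrow> real^3 \<Rightarrow> real"
  assumes b: "bilinear b" and sym: "\<And>x y. b x y = b y x"
  obtains u v w where "orthonormal3 (\<bullet>) u v w" "cross3 u v = w" "cross3 v w = u" "cross3 w u = v"
    "b u v = 0" "b v w = 0" "b w u = 0"
proof -
  have d: "DIM(real^3) \<ge> 2" by simp
  obtain u where u: "norm u = 1" "\<And>x. x \<bullet> u = 0 \<Longrightarrow> b u x = 0"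
    using ex_unit_critical[OF b sym d, of 0] by auto
  obtain v where v: "norm v = 1" "v \<bullet> u = 0" "\<And>x. x \<bullet> u = 0 \<Longrightarrow> x \<bullet> v = 0 \<Longrightarrow> b v x = 0"
    using ex_unit_critical[OF b sym d, of u] by auto
  define w where "w = cross3 u v"
  have uv: "u \<bullet> u = 1" "v \<bullet> v = 1" "u \<bullet> v = 0" "v \<bullet> u = 0"
    using u(1) v(1,2) by (auto simp: norm_eq_1 inner_commute)
  have wu: "w \<bullet> u = 0" "w \<bullet> v = 0" by (simp_all add: w_def dot_cross_self)
  have "(norm w)\<^sup>2 = 1"
    using norm_cross_dot[of u v] u(1) v(1) uv by (simp add: w_def)
  then have ww: "w \<bullet> w = 1" by (simp add: power2_norm_eq_inner)
  have "cross3 v w = u" "cross3 w u = v"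
    using uv by (simp_all add: w_def Lagrange cross_triple cross_skew[of "cross3 u v" u])
  moreover have "orthonormal3 (\<bullet>) u v w"
    using uv wu ww by (simp add: orthonormal3_def inner_commute)
  moreover have "b u v = 0" "b v w = 0" "b w u = 0"
    using u(2)[of v] v(3)[of w] u(2)[of w] v(2) wu sym[of w u] by auto
  ultimately show thesis by (intro that[of u v w]) (simp_all add: w_def)
qed

section \<open>Milnor frames\<close>

definition milnor_frame ::
    "('v::real_vector \<Rightarrow> 'v \<Rightarrow> 'v) \<Rightarrow> 'v \<Rightarrow> 'v \<Rightarrow> 'v \<Rightarrow> real \<Rightarrow> real \<Rightarrow> real \<Rightarrow> bool" where
  "milnor_frame br e1 e2 e3 l1 l2 l3 \<longleftrightarrow> basis3 e1 e2 e3 \<and>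
     br e1 e2 = l3 *\<^sub>R e3 \<and> br e2 e3 = l1 *\<^sub>R e1 \<and> br e3 e1 = l2 *\<^sub>R e2"

lemma milnor_frame_rotate:
  "milnor_frame br e1 e2 e3 l1 l2 l3 \<Longrightarrow> milnor_frame br e2 e3 e1 l2 l3 l1"
  by (auto simp: milnor_frame_def intro: basis3_rotate)

lemma lie_bracket_skew:
  assumes "lie_bracket br"
  shows "br x x = 0" "br y x = - br x y"
proof -
  have bb: "bilinear br" and alt: "br x x = 0" for x
    using assms by (auto simp: lie_bracket_def)
  show "br x x = 0" by (rule alt)
  have "br (x + y) (x + y) = br x y + br y x"
    unfolding bilinear_ladd[OF bb] bilinear_radd[OF bb] by (simp add: alt)
  then show "br y x = - br x y"
    unfolding alt by (simp add: eq_neg_iff_add_eq_0 add.commute)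
qed

lemma milnor_frame_brackets:
  assumes "lie_bracket br" "milnor_frame br e1 e2 e3 l1 l2 l3"
  shows "br e1 e1 = 0" "br e1 e2 = l3 *\<^sub>R e3" "br e1 e3 = - (l2 *\<^sub>R e2)"
    "br e2 e1 = - (l3 *\<^sub>R e3)" "br e2 e2 = 0" "br e2 e3 = l1 *\<^sub>R e1"
    "br e3 e1 = l2 *\<^sub>R e2" "br e3 e2 = - (l1 *\<^sub>R e1)" "br e3 e3 = 0"
  using assms(2) lie_bracket_skew[OF assms(1)] unfolding milnor_frame_def by metis+

text \<open>
  In orthonormal coordinates \<open>\<phi>\<close> the bracket is \<open>M\<close> applied to the cross product. The off-diagonal
  differences of the form \<open>b\<close> of \<open>M\<close> are, up to sign, the traces of the adjoint maps, so unimodularity makes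
  \<open>b\<close> symmetric, and an oriented orthonormal frame that diagonalizes \<open>b\<close> is a Milnor frame.
\<close>

lemma ex_orthonormal_milnor_frame:
  fixes br :: "'v::real_vector \<Rightarrow> 'v \<Rightarrow> 'v"
  assumes d: "dim (UNIV :: 'v set) = 3" and br: "lie_bracket br" and um: "unimodular br"
    and g: "metric_form g"
  obtains e1 e2 e3 l1 l2 l3 where "orthonormal3 g e1 e2 e3" "milnor_frame br e1 e2 e3 l1 l2 l3"
proof -
  have bl: "bilinear g" and sym: "g x y = g y x" for x y
    using g by (auto simp: metric_form_def symmetric_form_def)
  have bb: "bilinear br" using br by (simp add: lie_bracket_def)
  note bs = bilinear_ladd[OF bl] bilinear_radd[OF bl] bilinear_lmul[OF bl] bilinear_rmul[OF bl]
  note bbs = bilinear_ladd[OF bb] bilinear_radd[OF bb] bilinear_lmul[OF bb] bilinear_rmul[OF bb]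
  obtain u1 u2 u3 where o: "orthonormal3 g u1 u2 u3" using ex_orthonormal3[OF d g] .
  note B = orthonormal3_imp_basis3(1)[OF d g o] and expand = orthonormal3_imp_basis3(2)[OF d g o]
  have tr: "g (br x u1) u1 + g (br x u2) u2 + g (br x u3) u3 = 0" for x
  proof -
    have "linear (br x)" using bb by (simp add: bilinear_def)
    then have "lin_trace (br x) = g (br x u1) u1 + g (br x u2) u2 + g (br x u3) u3"
      using lin_trace_basis3[OF d _ B expand expand expand] by blast
    then show ?thesis using um by (simp add: unimodular_def)
  qed
  define \<phi> :: "real^3 \<Rightarrow> 'v" where "\<phi> x = (x $ 1) *\<^sub>R u1 + (x $ 2) *\<^sub>R u2 + (x $ 3) *\<^sub>R u3" for x
  define M :: "real^3 \<Rightarrow> 'v"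
    where "M x = (x $ 1) *\<^sub>R br u2 u3 + (x $ 2) *\<^sub>R br u3 u1 + (x $ 3) *\<^sub>R br u1 u2" for x
  have skew: "br u2 u1 = - br u1 u2" "br u3 u2 = - br u2 u3" "br u1 u3 = - br u3 u1"
    by (rule lie_bracket_skew(2)[OF br])+
  have M: "br (\<phi> x) (\<phi> y) = M (cross3 x y)" for x y
    by (simp add: \<phi>_def M_def bbs skew lie_bracket_skew(1)[OF br] cross_components algebra_simps)
  have o': "g u1 u1 = 1" "g u2 u2 = 1" "g u3 u3 = 1" "g u1 u2 = 0" "g u2 u3 = 0" "g u3 u1 = 0"
    "g u2 u1 = 0" "g u3 u2 = 0" "g u1 u3 = 0"
    using o sym[of u1 u2] sym[of u2 u3] sym[of u1 u3] by (simp_all add: orthonormal3_def)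
  have iso: "g (\<phi> x) (\<phi> y) = x \<bullet> y" for x y
    by (simp add: \<phi>_def bs o' inner_vec_def sum_3)
  define b where "b x y = g (M x) (\<phi> y)" for x y
  have "bilinear b"
    unfolding bilinear_def by (auto intro!: linearI simp: b_def M_def \<phi>_def bs algebra_simps)
  moreover have "b x y = b y x" for x y
  proof -
    have "g (br u1 u2) u2 = g (br u3 u1) u3" "g (br u2 u3) u3 = g (br u1 u2) u1"
      "g (br u3 u1) u1 = g (br u2 u3) u2"
      using tr[of u1] tr[of u2] tr[of u3]
      by (simp_all add: skew lie_bracket_skew(1)[OF br] bilinear_lneg[OF bl] bilinear_lzero[OF bl])
    then show ?thesis by (simp add: b_def M_def \<phi>_def bs algebra_simps)
  qed
  ultimately obtain p q r where pqr: "orthonormal3 (\<bullet>) p q r"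
    "cross3 p q = r" "cross3 q r = p" "cross3 r p = q" "b p q = 0" "b q r = 0" "b r p = 0"
    using ex_diagonalizing_frame[of b] by metis
  have b0: "b q p = 0" "b r q = 0" "b p r = 0"
    using pqr(5-7) \<open>\<And>x y. b x y = b y x\<close> by metis+
  have oe: "orthonormal3 g (\<phi> p) (\<phi> q) (\<phi> r)"
    using pqr(1) by (simp add: orthonormal3_def iso)
  have "v = g v (\<phi> p) *\<^sub>R \<phi> p + g v (\<phi> q) *\<^sub>R \<phi> q + g v (\<phi> r) *\<^sub>R \<phi> r" for v
    by (rule orthonormal3_imp_basis3(2)[OF d g oe])
  from this[of "M p"] this[of "M q"] this[of "M r"]
  have "M p = b p p *\<^sub>R \<phi> p" "M q = b q q *\<^sub>R \<phi> q" "M r = b r r *\<^sub>R \<phi> r"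
    using pqr(5-7) b0 by (simp_all add: b_def)
  then have "milnor_frame br (\<phi> p) (\<phi> q) (\<phi> r) (b p p) (b q q) (b r r)"
    using orthonormal3_imp_basis3(1)[OF d g oe] by (simp add: milnor_frame_def M pqr(2-4))
  with oe show thesis by (rule that)
qed

definition killing :: "('v::real_vector \<Rightarrow> 'v \<Rightarrow> 'v) \<Rightarrow> 'v \<Rightarrow> 'v \<Rightarrow> real" where
  "killing br x y = lin_trace (\<lambda>z. br x (br y z))"

lemma killing_milnor_frame:
  fixes br :: "'v::real_vector \<Rightarrow> 'v \<Rightarrow> 'v"
  assumes d: "dim (UNIV :: 'v set) = 3" and br: "lie_bracket br"
    and f: "milnor_frame br e1 e2 e3 l1 l2 l3"
    and x: "x = x1 *\<^sub>R e1 + x2 *\<^sub>R e2 + x3 *\<^sub>R e3"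
  shows "killing br x x = - 2 * (l2 * l3 * x1\<^sup>2 + l3 * l1 * x2\<^sup>2 + l1 * l2 * x3\<^sup>2)"
proof -
  have bb: "bilinear br" using br by (simp add: lie_bracket_def)
  note bbs = bilinear_ladd[OF bb] bilinear_radd[OF bb] bilinear_lmul[OF bb] bilinear_rmul[OF bb]
    bilinear_rneg[OF bb] bilinear_rsub[OF bb] bilinear_rzero[OF bb]
  note t = milnor_frame_brackets[OF br f]
  have lin: "linear (\<lambda>z. br x (br x z))"
    by (rule linearI) (simp_all add: bbs)
  have e: "br x (br x e1) = (- (l1 * l2 * x3\<^sup>2 + l3 * l1 * x2\<^sup>2)) *\<^sub>R e1
        + (l3 * l2 * x1 * x2) *\<^sub>R e2 + (l2 * l3 * x1 * x3) *\<^sub>R e3"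
    "br x (br x e2) = (l3 * l1 * x1 * x2) *\<^sub>R e1
        + (- (l1 * l2 * x3\<^sup>2 + l2 * l3 * x1\<^sup>2)) *\<^sub>R e2 + (l1 * l3 * x2 * x3) *\<^sub>R e3"
    "br x (br x e3) = (l2 * l1 * x1 * x3) *\<^sub>R e1
        + (l1 * l2 * x2 * x3) *\<^sub>R e2 + (- (l3 * l1 * x2\<^sup>2 + l2 * l3 * x1\<^sup>2)) *\<^sub>R e3"
    by (simp_all add: x bbs t algebra_simps power2_eq_square)
  show ?thesis
    unfolding killing_def
    using lin_trace_basis3[OF d lin _ e] f by (simp add: milnor_frame_def algebra_simps)
qed

text \<open>
  The parameters \<open>m1, m2, m3\<close> with \<open>l1 = m2 + m3\<close> and cyclically are Milnor's: they are the connection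
  coefficients, which the Koszul formula reads off the brackets. The derivatives along \<open>e2\<close> and \<open>e3\<close>
  follow by rotating the frame.
\<close>

lemma levi_civita_milnor_frame:
  fixes br :: "'v::real_vector \<Rightarrow> 'v \<Rightarrow> 'v"
  assumes d: "dim (UNIV :: 'v set) = 3" and br: "lie_bracket br" and g: "metric_form g"
    and o: "orthonormal3 g e1 e2 e3"
    and f: "milnor_frame br e1 e2 e3 (m2 + m3) (m3 + m1) (m1 + m2)"
  shows "levi_civita br g e1 e1 = 0"
    and "levi_civita br g e1 e2 = m1 *\<^sub>R e3"
    and "levi_civita br g e1 e3 = - m1 *\<^sub>R e2"
proof -
  have bl: "bilinear g" and sym: "g x y = g y x" for x y
    using g by (auto simp: metric_form_def symmetric_form_def)
  note bs = bilinear_lmul[OF bl] bilinear_lneg[OF bl] bilinear_lzero[OF bl]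
  have d0: "dim (UNIV :: 'v set) \<noteq> 0" using d by simp
  have lc: "is_levi_civita br g (levi_civita br g)"
    unfolding levi_civita_def by (rule theI'[OF levi_civita_unique[OF d0 br g]])
  note K = levi_civita_koszul[OF g lc]
  note t = milnor_frame_brackets[OF br f]
  have o': "g e1 e1 = 1" "g e2 e2 = 1" "g e3 e3 = 1" "g e1 e2 = 0" "g e2 e3 = 0" "g e3 e1 = 0"
    "g e2 e1 = 0" "g e3 e2 = 0" "g e1 e3 = 0"
    using o sym[of e1 e2] sym[of e2 e3] sym[of e1 e3] by (simp_all add: orthonormal3_def)
  have expand: "v = g v e1 *\<^sub>R e1 + g v e2 *\<^sub>R e2 + g v e3 *\<^sub>R e3" for v
    by (rule orthonormal3_imp_basis3(2)[OF d g o])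
  show "levi_civita br g e1 e1 = 0"
    using K[of e1 e1 e1] K[of e1 e1 e2] K[of e1 e1 e3]
    by (subst expand) (simp add: t bs o')
  show "levi_civita br g e1 e2 = m1 *\<^sub>R e3"
    using K[of e1 e2 e1] K[of e1 e2 e2] K[of e1 e2 e3]
    by (subst expand) (simp add: t bs o')
  show "levi_civita br g e1 e3 = - m1 *\<^sub>R e2"
    using K[of e1 e3 e1] K[of e1 e3 e2] K[of e1 e3 e3]
    by (subst expand) (simp add: t bs o')
qed

lemma Ric_milnor_frame:
  fixes br :: "'v::real_vector \<Rightarrow> 'v \<Rightarrow> 'v"
  assumes d: "dim (UNIV :: 'v set) = 3" and br: "lie_bracket br" and g: "metric_form g"
    and o: "orthonormal3 g e1 e2 e3"
    and f: "milnor_frame br e1 e2 e3 (m2 + m3) (m3 + m1) (m1 + m2)"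
  shows "Ric br g e1 e1 = 2 * m2 * m3" and "Ric br g e1 e2 = 0"
proof -
  have d0: "dim (UNIV :: 'v set) \<noteq> 0" using d by simp
  define D where "D = levi_civita br g"
  have "is_levi_civita br g D"
    unfolding levi_civita_def D_def by (rule theI'[OF levi_civita_unique[OF d0 br g]])
  then have bD: "bilinear D" by (simp add: is_levi_civita_def)
  have bb: "bilinear br" using br by (simp add: lie_bracket_def)
  note bs = bilinear_ladd[OF bD] bilinear_radd[OF bD] bilinear_lmul[OF bD] bilinear_rmul[OF bD]
    bilinear_rneg[OF bD] bilinear_lneg[OF bD] bilinear_rzero[OF bD] bilinear_lzero[OF bD]
    bilinear_lsub[OF bD] bilinear_rsub[OF bD] bilinear_ladd[OF bb] bilinear_lmul[OF bb]
  note f2 = milnor_frame_rotate[OF f] and o2 = orthonormal3_rotate[OF o]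
  note f3 = milnor_frame_rotate[OF f2] and o3 = orthonormal3_rotate[OF o2]
  note t = milnor_frame_brackets[OF br f]
  note D = levi_civita_milnor_frame[OF d br g o f, folded D_def]
    levi_civita_milnor_frame[OF d br g o2 f2, folded D_def]
    levi_civita_milnor_frame[OF d br g o3 f3, folded D_def]
  have R: "riemann br g x y z = D x (D y z) - D y (D x z) - D (br x y) z" for x y z
    by (simp add: riemann_def D_def Let_def)
  have lin: "linear (\<lambda>x. riemann br g x y z)" for y z
    by (rule linearI) (simp_all add: R bs algebra_simps)
  have B: "basis3 e1 e2 e3" using f by (simp add: milnor_frame_def)
  have "riemann br g e1 e1 e1 = 0 *\<^sub>R e1 + 0 *\<^sub>R e2 + 0 *\<^sub>R e3"
    "riemann br g e2 e1 e1 = 0 *\<^sub>R e1 + (m3 * (m1 + m2) - m1 * m2) *\<^sub>R e2 + 0 *\<^sub>R e3"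
    "riemann br g e3 e1 e1 = 0 *\<^sub>R e1 + 0 *\<^sub>R e2 + (m2 * (m3 + m1) - m1 * m3) *\<^sub>R e3"
    by (simp_all add: R D t bs algebra_simps)
  from lin_trace_basis3[OF d lin B this]
  show "Ric br g e1 e1 = 2 * m2 * m3" by (simp add: Ric_def algebra_simps)
  have "riemann br g e1 e1 e2 = 0 *\<^sub>R e1 + 0 *\<^sub>R e2 + 0 *\<^sub>R e3"
    "riemann br g e2 e1 e2 = (- (m3 * (m1 + m2) - m1 * m2)) *\<^sub>R e1 + 0 *\<^sub>R e2 + 0 *\<^sub>R e3"
    "riemann br g e3 e1 e2 = 0 *\<^sub>R e1 + 0 *\<^sub>R e2 + 0 *\<^sub>R e3"
    by (simp_all add: R D t bs algebra_simps)
  from lin_trace_basis3[OF d lin B this]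
  show "Ric br g e1 e2 = 0" by (simp add: Ric_def)
qed

section \<open>Ricci frames\<close>

text \<open>
  All that the uniqueness argument needs to know about a metric with Ricci form \<open>Q\<close>. Only three of the
  off-diagonal entries are listed, since the form will be symmetric.
\<close>

definition ricci_frame :: "('v::real_vector \<Rightarrow> 'v \<Rightarrow> 'v) \<Rightarrow> ('v \<Rightarrow> 'v \<Rightarrow> real) \<Rightarrow>
    'v \<Rightarrow> 'v \<Rightarrow> 'v \<Rightarrow> real \<Rightarrow> real \<Rightarrow> real \<Rightarrow> bool" where
  "ricci_frame br Q e1 e2 e3 m1 m2 m3 \<longleftrightarrow>
     milnor_frame br e1 e2 e3 (m2 + m3) (m3 + m1) (m1 + m2) \<and>
     Q e1 e1 = 2 * m2 * m3 \<and> Q e2 e2 = 2 * m3 * m1 \<and> Q e3 e3 = 2 * m1 * m2 \<and>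
     Q e1 e2 = 0 \<and> Q e2 e3 = 0 \<and> Q e3 e1 = 0"

lemma ricci_frame_rotate:
  "ricci_frame br Q e1 e2 e3 m1 m2 m3 \<Longrightarrow> ricci_frame br Q e2 e3 e1 m2 m3 m1"
  by (auto simp: ricci_frame_def intro: milnor_frame_rotate)

lemma ex_ricci_frame:
  fixes br :: "'v::real_vector \<Rightarrow> 'v \<Rightarrow> 'v"
  assumes d: "dim (UNIV :: 'v set) = 3" and br: "lie_bracket br" and um: "unimodular br"
    and g: "metric_form g"
  obtains e1 e2 e3 m1 m2 m3 where "ricci_frame br (Ric br g) e1 e2 e3 m1 m2 m3"
proof -
  obtain e1 e2 e3 l1 l2 l3 where o: "orthonormal3 g e1 e2 e3"
    and f0: "milnor_frame br e1 e2 e3 l1 l2 l3"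
    using ex_orthonormal_milnor_frame[OF d br um g] .
  define m1 m2 m3 where "m1 = (l2 + l3 - l1) / 2" and "m2 = (l3 + l1 - l2) / 2"
    and "m3 = (l1 + l2 - l3) / 2"
  have "l1 = m2 + m3" "l2 = m3 + m1" "l3 = m1 + m2"
    by (simp_all add: m1_def m2_def m3_def field_simps)
  then have f: "milnor_frame br e1 e2 e3 (m2 + m3) (m3 + m1) (m1 + m2)"
    using f0 by simp
  note f2 = milnor_frame_rotate[OF f] and o2 = orthonormal3_rotate[OF o]
  note f3 = milnor_frame_rotate[OF f2] and o3 = orthonormal3_rotate[OF o2]
  have "ricci_frame br (Ric br g) e1 e2 e3 m1 m2 m3"
    using Ric_milnor_frame[OF d br g o f] Ric_milnor_frame[OF d br g o2 f2]
      Ric_milnor_frame[OF d br g o3 f3] f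
    by (simp add: ricci_frame_def)
  then show thesis by (rule that)
qed

text \<open>
  Half the first diagonal entry, in a frame with parameters \<open>a, b, c\<close>, of the Ricci form plus \<open>k\<close> times
  the Killing form; the other two entries arise by cyclic shifts.
\<close>

definition pencil_coeff :: "real \<Rightarrow> real \<Rightarrow> real \<Rightarrow> real \<Rightarrow> real" where
  "pencil_coeff k a b c = b * c - k * ((c + a) * (a + b))"

lemma ricci_frame_quadratic:
  fixes br :: "'v::real_vector \<Rightarrow> 'v \<Rightarrow> 'v"
  assumes d: "dim (UNIV :: 'v set) = 3" and br: "lie_bracket br" and Q: "symmetric_form Q"
    and f: "ricci_frame br Q e1 e2 e3 m1 m2 m3"
    and x: "x = x1 *\<^sub>R e1 + x2 *\<^sub>R e2 + x3 *\<^sub>R e3"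
  shows "Q x x + k * killing br x x =
    2 * (pencil_coeff k m1 m2 m3 * x1\<^sup>2 + pencil_coeff k m2 m3 m1 * x2\<^sup>2
       + pencil_coeff k m3 m1 m2 * x3\<^sup>2)"
proof -
  have bl: "bilinear Q" and sym: "Q x y = Q y x" for x y
    using Q by (auto simp: symmetric_form_def)
  note bs = bilinear_ladd[OF bl] bilinear_radd[OF bl] bilinear_lmul[OF bl] bilinear_rmul[OF bl]
  have M: "milnor_frame br e1 e2 e3 (m2 + m3) (m3 + m1) (m1 + m2)"
    using f by (simp add: ricci_frame_def)
  have "Q e1 e1 = 2 * m2 * m3" "Q e2 e2 = 2 * m3 * m1" "Q e3 e3 = 2 * m1 * m2"
    "Q e1 e2 = 0" "Q e2 e3 = 0" "Q e3 e1 = 0" "Q e2 e1 = 0" "Q e3 e2 = 0" "Q e1 e3 = 0"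
    using f sym[of e1 e2] sym[of e2 e3] sym[of e3 e1] by (simp_all add: ricci_frame_def)
  then have "Q x x = 2 * (m2 * m3 * x1\<^sup>2 + m3 * m1 * x2\<^sup>2 + m1 * m2 * x3\<^sup>2)"
    by (simp add: x bs algebra_simps power2_eq_square)
  then show ?thesis
    by (simp add: killing_milnor_frame[OF d br M x] pencil_coeff_def algebra_simps)
qed

section \<open>Relative invariants of a bracket and a form\<close>

text \<open>
  Let \<open>A\<close> be the matrix of the second frame in terms of the first, with determinant \<open>\<delta>\<close> and cofactor
  matrix \<open>C\<close>. The brackets of the two frames are related by \<open>diag(l) C = A diag(k)\<close>, and the form
  has the matrix \<open>diag(T') = A\<^sup>T diag(T) A\<close> in the second one. The determinants of these two equations
  are the first and the last claim. Together they make \<open>diag(k) diag(T')\<close> conjugate to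
  \<open>\<delta> diag(l) diag(T)\<close>, and the traces are the remaining claim.
\<close>

lemma milnor_frame_change:
  assumes br: "lie_bracket br" and T: "symmetric_form T"
    and e: "milnor_frame br e1 e2 e3 l1 l2 l3" "T e1 e2 = 0" "T e2 e3 = 0" "T e3 e1 = 0"
    and f: "milnor_frame br f1 f2 f3 k1 k2 k3" "T f1 f2 = 0" "T f2 f3 = 0" "T f3 f1 = 0"
  obtains \<delta> where "\<delta> \<noteq> 0" "k1 * k2 * k3 = \<delta> * (l1 * l2 * l3)"
    "k1 * T f1 f1 + k2 * T f2 f2 + k3 * T f3 f3 = \<delta> * (l1 * T e1 e1 + l2 * T e2 e2 + l3 * T e3 e3)"
    "T f1 f1 * T f2 f2 * T f3 f3 = \<delta>\<^sup>2 * (T e1 e1 * T e2 e2 * T e3 e3)"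
proof -
  have bl: "bilinear T" and sym: "T x y = T y x" for x y
    using T by (auto simp: symmetric_form_def)
  have bb: "bilinear br" using br by (simp add: lie_bracket_def)
  note bs = bilinear_ladd[OF bl] bilinear_radd[OF bl] bilinear_lmul[OF bl] bilinear_rmul[OF bl]
  note bbs = bilinear_ladd[OF bb] bilinear_radd[OF bb] bilinear_lmul[OF bb] bilinear_rmul[OF bb]
    bilinear_rneg[OF bb] bilinear_rsub[OF bb] bilinear_rzero[OF bb]
  have Be: "basis3 e1 e2 e3" and Bf: "basis3 f1 f2 f3"
    using e(1) f(1) by (simp_all add: milnor_frame_def)
  obtain x1 y1 z1 where f1: "f1 = x1 *\<^sub>R e1 + y1 *\<^sub>R e2 + z1 *\<^sub>R e3" using basis3_expand[OF Be] .
  obtain x2 y2 z2 where f2: "f2 = x2 *\<^sub>R e1 + y2 *\<^sub>R e2 + z2 *\<^sub>R e3" using basis3_expand[OF Be] .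
  obtain x3 y3 z3 where f3: "f3 = x3 *\<^sub>R e1 + y3 *\<^sub>R e2 + z3 *\<^sub>R e3" using basis3_expand[OF Be] .
  define X1 Y1 Z1 X2 Y2 Z2 X3 Y3 Z3
    where cof: "X1 = y2 * z3 - y3 * z2" "Y1 = z2 * x3 - z3 * x2" "Z1 = x2 * y3 - x3 * y2"
      "X2 = y3 * z1 - y1 * z3" "Y2 = z3 * x1 - z1 * x3" "Z2 = x3 * y1 - x1 * y3"
      "X3 = y1 * z2 - y2 * z1" "Y3 = z1 * x2 - z2 * x1" "Z3 = x1 * y2 - x2 * y1"
  define \<delta> where "\<delta> = x1 * X1 + y1 * Y1 + z1 * Z1"
  note t = milnor_frame_brackets[OF br e(1)]
  have eqI: "a = a' \<and> b = b' \<and> c = c'"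
    if "a *\<^sub>R e1 + b *\<^sub>R e2 + c *\<^sub>R e3 = a' *\<^sub>R e1 + b' *\<^sub>R e2 + c' *\<^sub>R e3" for a b c a' b' c'
    using basis3_coeffs_zero[OF Be, of "a - a'" "b - b'" "c - c'"] that by (simp add: algebra_simps)
  have "br f2 f3 = (l1 * X1) *\<^sub>R e1 + (l2 * Y1) *\<^sub>R e2 + (l3 * Z1) *\<^sub>R e3"
    by (simp add: f2 f3 bbs t cof algebra_simps)
  moreover have "br f2 f3 = (k1 * x1) *\<^sub>R e1 + (k1 * y1) *\<^sub>R e2 + (k1 * z1) *\<^sub>R e3"
    using f(1) by (simp add: milnor_frame_def f1 algebra_simps)
  ultimately have r1: "l1 * X1 = k1 * x1 \<and> l2 * Y1 = k1 * y1 \<and> l3 * Z1 = k1 * z1"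
    by (intro eqI) simp
  have "br f3 f1 = (l1 * X2) *\<^sub>R e1 + (l2 * Y2) *\<^sub>R e2 + (l3 * Z2) *\<^sub>R e3"
    by (simp add: f3 f1 bbs t cof algebra_simps)
  moreover have "br f3 f1 = (k2 * x2) *\<^sub>R e1 + (k2 * y2) *\<^sub>R e2 + (k2 * z2) *\<^sub>R e3"
    using f(1) by (simp add: milnor_frame_def f2 algebra_simps)
  ultimately have r2: "l1 * X2 = k2 * x2 \<and> l2 * Y2 = k2 * y2 \<and> l3 * Z2 = k2 * z2"
    by (intro eqI) simp
  have "br f1 f2 = (l1 * X3) *\<^sub>R e1 + (l2 * Y3) *\<^sub>R e2 + (l3 * Z3) *\<^sub>R e3"
    by (simp add: f1 f2 bbs t cof algebra_simps)
  moreover have "br f1 f2 = (k3 * x3) *\<^sub>R e1 + (k3 * y3) *\<^sub>R e2 + (k3 * z3) *\<^sub>R e3"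
    using f(1) by (simp add: milnor_frame_def f3 algebra_simps)
  ultimately have r3: "l1 * X3 = k3 * x3 \<and> l2 * Y3 = k3 * y3 \<and> l3 * Z3 = k3 * z3"
    by (intro eqI) simp
  have row: "x1 * X1 + x2 * X2 + x3 * X3 = \<delta>" "y1 * Y1 + y2 * Y2 + y3 * Y3 = \<delta>"
    "z1 * Z1 + z2 * Z2 + z3 * Z3 = \<delta>"
    by (simp_all add: \<delta>_def cof algebra_simps)
  have col: "x2 * X2 + y2 * Y2 + z2 * Z2 = \<delta>" "x3 * X3 + y3 * Y3 + z3 * Z3 = \<delta>"
    by (simp_all add: \<delta>_def cof algebra_simps)
  \<comment> \<open>If the determinant vanished, the cofactors would give linear relations among the second frame;
    hence they vanish, and then \<open>f2\<close> and \<open>f3\<close> are dependent.\<close>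
  have \<delta>: "\<delta> \<noteq> 0"
  proof
    assume "\<delta> = 0"
    then have \<delta>0: "x1 * (y2 * z3 - y3 * z2) + y1 * (z2 * x3 - z3 * x2) + z1 * (x2 * y3 - x3 * y2) = 0"
      by (simp add: \<delta>_def cof)
    have 0: "X1 *\<^sub>R f1 + X2 *\<^sub>R f2 + X3 *\<^sub>R f3 = \<delta> *\<^sub>R e1"
      "Y1 *\<^sub>R f1 + Y2 *\<^sub>R f2 + Y3 *\<^sub>R f3 = \<delta> *\<^sub>R e2"
      "Z1 *\<^sub>R f1 + Z2 *\<^sub>R f2 + Z3 *\<^sub>R f3 = \<delta> *\<^sub>R e3"
      by (simp_all add: f1 f2 f3 \<delta>_def cof algebra_simps)
    then have z: "X1 = 0" "Y1 = 0" "Z1 = 0"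
      using basis3_coeffs_zero[OF Bf] \<open>\<delta> = 0\<close> by (metis scaleR_zero_left)+
    have "x3 *\<^sub>R f2 - x2 *\<^sub>R f3 = (- Z1) *\<^sub>R e2 + Y1 *\<^sub>R e3"
      "y3 *\<^sub>R f2 - y2 *\<^sub>R f3 = Z1 *\<^sub>R e1 + (- X1) *\<^sub>R e3"
      "z3 *\<^sub>R f2 - z2 *\<^sub>R f3 = (- Y1) *\<^sub>R e1 + X1 *\<^sub>R e2"
      by (simp_all add: f2 f3 cof algebra_simps)
    then have "0 *\<^sub>R f1 + x3 *\<^sub>R f2 + (- x2) *\<^sub>R f3 = 0" "0 *\<^sub>R f1 + y3 *\<^sub>R f2 + (- y2) *\<^sub>R f3 = 0"
      "0 *\<^sub>R f1 + z3 *\<^sub>R f2 + (- z2) *\<^sub>R f3 = 0"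
      by (simp_all add: z)
    then have "x2 = 0" "y2 = 0" "z2 = 0"
      using basis3_coeffs_zero(3)[OF Bf] by (metis neg_equal_0_iff_equal)+
    then have "0 *\<^sub>R f1 + 1 *\<^sub>R f2 + 0 *\<^sub>R f3 = 0" by (simp add: f2)
    from basis3_coeffs_zero(2)[OF Bf this] show False by simp
  qed
  have sT: "T e2 e1 = 0" "T e3 e2 = 0" "T e1 e3 = 0"
    using e(2-4) sym[of e1 e2] sym[of e2 e3] sym[of e1 e3] by auto
  define a b c where "a = T e1 e1" and "b = T e2 e2" and "c = T e3 e3"
  have G: "T f1 f1 = a * x1\<^sup>2 + b * y1\<^sup>2 + c * z1\<^sup>2" "T f2 f2 = a * x2\<^sup>2 + b * y2\<^sup>2 + c * z2\<^sup>2"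
    "T f3 f3 = a * x3\<^sup>2 + b * y3\<^sup>2 + c * z3\<^sup>2"
    "T f1 f2 = a * x1 * x2 + b * y1 * y2 + c * z1 * z2" "T f2 f3 = a * x2 * x3 + b * y2 * y3 + c * z2 * z3"
    "T f3 f1 = a * x3 * x1 + b * y3 * y1 + c * z3 * z1"
    by (simp_all add: f1 f2 f3 bs e(2-4) sT a_def b_def c_def algebra_simps power2_eq_square)
  show thesis
  proof
    show "\<delta> \<noteq> 0" by (rule \<delta>)
    have detC: "X1 * (Y2 * Z3 - Y3 * Z2) + Y1 * (Z2 * X3 - Z3 * X2) + Z1 * (X2 * Y3 - X3 * Y2) = \<delta>\<^sup>2"
      unfolding \<delta>_def cof by algebra
    have "\<delta> * (k1 * k2 * k3) =
        (k1 * x1) * ((k2 * y2) * (k3 * z3) - (k3 * y3) * (k2 * z2))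
      + (k1 * y1) * ((k2 * z2) * (k3 * x3) - (k3 * z3) * (k2 * x2))
      + (k1 * z1) * ((k2 * x2) * (k3 * y3) - (k3 * x3) * (k2 * y2))"
      unfolding \<delta>_def cof by algebra
    also have "\<dots> =
        (l1 * X1) * ((l2 * Y2) * (l3 * Z3) - (l2 * Y3) * (l3 * Z2))
      + (l2 * Y1) * ((l3 * Z2) * (l1 * X3) - (l3 * Z3) * (l1 * X2))
      + (l3 * Z1) * ((l1 * X2) * (l2 * Y3) - (l1 * X3) * (l2 * Y2))"
      using r1 r2 r3 by simp
    also have "\<dots> = l1 * l2 * l3 *
       (X1 * (Y2 * Z3 - Y3 * Z2) + Y1 * (Z2 * X3 - Z3 * X2) + Z1 * (X2 * Y3 - X3 * Y2))"
      by algebra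
    also have "\<dots> = \<delta> * (\<delta> * (l1 * l2 * l3))"
      by (simp add: detC power2_eq_square)
    finally show "k1 * k2 * k3 = \<delta> * (l1 * l2 * l3)" using \<delta> by simp
    have "k1 * T f1 f1 + k2 * T f2 f2 + k3 * T f3 f3 =
        a * ((k1 * x1) * x1 + (k2 * x2) * x2 + (k3 * x3) * x3)
      + b * ((k1 * y1) * y1 + (k2 * y2) * y2 + (k3 * y3) * y3)
      + c * ((k1 * z1) * z1 + (k2 * z2) * z2 + (k3 * z3) * z3)"
      unfolding G by algebra
    also have "\<dots> = a * ((l1 * X1) * x1 + (l1 * X2) * x2 + (l1 * X3) * x3)
      + b * ((l2 * Y1) * y1 + (l2 * Y2) * y2 + (l2 * Y3) * y3)
      + c * ((l3 * Z1) * z1 + (l3 * Z2) * z2 + (l3 * Z3) * z3)"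
      by (simp only: r1 r2 r3)
    also have "\<dots> = a * l1 * (x1 * X1 + x2 * X2 + x3 * X3) + b * l2 * (y1 * Y1 + y2 * Y2 + y3 * Y3)
      + c * l3 * (z1 * Z1 + z2 * Z2 + z3 * Z3)"
      by algebra
    finally show "k1 * T f1 f1 + k2 * T f2 f2 + k3 * T f3 f3 =
        \<delta> * (l1 * T e1 e1 + l2 * T e2 e2 + l3 * T e3 e3)"
      unfolding row a_def b_def c_def by algebra
    have "T f1 f1 * T f2 f2 * T f3 f3 + 2 * T f1 f2 * T f2 f3 * T f3 f1 - T f1 f1 * (T f2 f3)\<^sup>2
       - T f2 f2 * (T f3 f1)\<^sup>2 - T f3 f3 * (T f1 f2)\<^sup>2 = \<delta>\<^sup>2 * (a * b * c)"
      unfolding G \<delta>_def cof by algebra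
    then show "T f1 f1 * T f2 f2 * T f3 f3 = \<delta>\<^sup>2 * (T e1 e1 * T e2 e2 * T e3 e3)"
      by (simp add: f(2-4) a_def b_def c_def)
  qed
qed

section \<open>The equation for the scale\<close>

text \<open>
  With \<open>k = sqrt c\<close> both equations become \<open>1 - k\<^sup>2 \<theta> = 2 k\<^sup>3 s\<close>, where \<open>s = \<plusminus> sqrt D\<close> has the common sign.
  Eliminating \<open>\<theta>\<close> from the equations for \<open>k1\<close> and \<open>k2\<close> leaves
  \<open>(k2 - k1) (k1 + k2 + 2 s k1\<^sup>2 k2\<^sup>2) = 0\<close>. The second factor can vanish only if \<open>2 k\<^sup>3 s\<close> is below
  \<open>- 2\<close> for the larger of the two and above \<open>- 2\<close> for the smaller.
\<close>

lemma scale_unique: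
  fixes c1 c2 \<theta> D :: real
  assumes c: "c1 > 0" "c2 > 0"
    and sq: "(1 - c1 * \<theta>)\<^sup>2 = 4 * c1 ^ 3 * D" "(1 - c2 * \<theta>)\<^sup>2 = 4 * c2 ^ 3 * D"
    and sgn: "sgn (1 - c1 * \<theta>) = sgn (1 - c2 * \<theta>)"
    and w: "- 2 \<le> 1 - c1 * \<theta> \<and> - 2 \<le> 1 - c2 * \<theta> \<or> 1 - c1 * \<theta> \<le> - 2 \<and> 1 - c2 * \<theta> \<le> - 2"
  shows "c1 = c2"
proof -
  define k1 k2 s where "k1 = sqrt c1" and "k2 = sqrt c2" and "s = sgn (1 - c1 * \<theta>) * sqrt D"
  have k: "k1 > 0" "k2 > 0" using c by (simp_all add: k1_def k2_def)
  have c12: "c1 = k1\<^sup>2" "c2 = k2\<^sup>2" using c by (simp_all add: k1_def k2_def)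
  have root: "1 - c * \<theta> = sgn (1 - c * \<theta>) * (2 * sqrt c ^ 3 * sqrt D)"
    if "c > 0" "(1 - c * \<theta>)\<^sup>2 = 4 * c ^ 3 * D" for c
  proof -
    have "\<bar>1 - c * \<theta>\<bar> = sqrt ((1 - c * \<theta>)\<^sup>2)" by simp
    also have "\<dots> = 2 * sqrt c ^ 3 * sqrt D"
      unfolding that(2) by (simp add: real_sqrt_mult real_sqrt_power)
    finally show ?thesis by (metis sgn_mult_abs)
  qed
  have w1: "1 - k1\<^sup>2 * \<theta> = 2 * k1 ^ 3 * s" and w2: "1 - k2\<^sup>2 * \<theta> = 2 * k2 ^ 3 * s"
    using root[OF c(1) sq(1)] root[OF c(2) sq(2)] sgn
    by (simp_all add: s_def c12[symmetric] k1_def[symmetric] k2_def[symmetric] mult.left_commute)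
  have "(k2 - k1) * (k1 + k2 + 2 * s * k1\<^sup>2 * k2\<^sup>2) = 0"
    using w1 w2 by algebra
  moreover have "k1 + k2 + 2 * s * k1\<^sup>2 * k2\<^sup>2 \<noteq> 0" if "k1 \<noteq> k2"
  proof
    assume "k1 + k2 + 2 * s * k1\<^sup>2 * k2\<^sup>2 = 0"
    then have s: "2 * s * k1\<^sup>2 * k2\<^sup>2 = - (k1 + k2)" by simp
    \<comment> \<open>A second solution lies on the other side of the critical value \<open>- 2\<close>.\<close>
    have opposite: "2 * b ^ 3 * s < - 2 \<and> 2 * a ^ 3 * s > - 2"
      if ab: "0 < a" "a < b" "2 * s * a\<^sup>2 * b\<^sup>2 = - (a + b)" for a b
    proof
      have "a * a < b * a" "a * b < b * b" using ab(1,2) by simp_all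
      then have le: "(2 * b ^ 3 * s) * a\<^sup>2 < (- 2) * a\<^sup>2" "(- 2) * b\<^sup>2 < (2 * a ^ 3 * s) * b\<^sup>2"
        using arg_cong[OF ab(3), of "\<lambda>z. b * z"] arg_cong[OF ab(3), of "\<lambda>z. a * z"]
        by (simp_all add: power2_eq_square power3_eq_cube algebra_simps)
      show "2 * b ^ 3 * s < - 2" by (rule mult_right_less_imp_less[OF le(1)]) simp
      show "2 * a ^ 3 * s > - 2" by (rule mult_right_less_imp_less[OF le(2)]) simp
    qed
    have s': "2 * s * k2\<^sup>2 * k1\<^sup>2 = - (k2 + k1)" using s by algebra
    show False
      using opposite[OF k(1) _ s] opposite[OF k(2) _ s'] \<open>k1 \<noteq> k2\<close> w
      unfolding c12 w1 w2 by linarith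
  qed
  ultimately show ?thesis by (auto simp: c12)
qed

section \<open>The pencil spanned by the Ricci form and the Killing form\<close>

text \<open>
  The sums \<open>b + c\<close>, \<open>c + a\<close>, \<open>a + b\<close> are the structure constants. Cyclic shifts and a change of
  orientation reduce every mixed pattern of signs to \<open>(+, +, -)\<close>.
\<close>

lemma mixed_signs_wlog:
  fixes P :: "real \<Rightarrow> real \<Rightarrow> real \<Rightarrow> bool"
  assumes rot: "\<And>a b c. P b c a \<Longrightarrow> P a b c" and neg: "\<And>a b c. P (- a) (- b) (- c) \<Longrightarrow> P a b c"
    and base: "\<And>a b c. b + c > 0 \<Longrightarrow> c + a > 0 \<Longrightarrow> a + b < 0 \<Longrightarrow> P a b c"
    and nz: "(b + c) * (c + a) * (a + b) \<noteq> 0"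
    and mixed: "\<not> (b + c > 0 \<and> c + a > 0 \<and> a + b > 0)" "\<not> (b + c < 0 \<and> c + a < 0 \<and> a + b < 0)"
  shows "P a b c"
proof -
  have one: "P a b c" if "a + b < 0 \<and> b + c > 0 \<and> c + a > 0 \<or> b + c < 0 \<and> c + a > 0 \<and> a + b > 0 \<or>
      c + a < 0 \<and> a + b > 0 \<and> b + c > 0" for a b c
    using that base[of b c a] base[of c a b] base[of a b c] rot by blast
  show ?thesis
  proof (cases "a + b < 0 \<and> b + c > 0 \<and> c + a > 0 \<or> b + c < 0 \<and> c + a > 0 \<and> a + b > 0 \<or>
      c + a < 0 \<and> a + b > 0 \<and> b + c > 0")
    case True
    then show ?thesis by (rule one)
  next
    case False
    have "b + c \<noteq> 0" "c + a \<noteq> 0" "a + b \<noteq> 0" using nz by auto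
    then have "P (- a) (- b) (- c)"
      by (intro one) (use False mixed in \<open>smt (verit)\<close>)
    then show ?thesis by (rule neg)
  qed
qed

text \<open>
  The quotient \<open>w\<close> of \<open>2 m\<^sub>1 m\<^sub>2 m\<^sub>3\<close> by the product of the structure constants. For a solution with
  constant \<open>c\<close> it equals \<open>1 - c \<theta>\<close>, so its position relative to \<open>0\<close> and \<open>- 2\<close> selects the branch
  of the equation for \<open>c\<close>.
\<close>

definition ricci_ratio :: "real \<Rightarrow> real \<Rightarrow> real \<Rightarrow> real" where
  "ricci_ratio a b c = 2 * a * b * c / ((b + c) * (c + a) * (a + b))"

lemma ricci_ratio_rotate: "ricci_ratio b c a = ricci_ratio a b c"
  by (simp add: ricci_ratio_def mult_ac)

lemma ricci_ratio_neg: "ricci_ratio (- a) (- b) (- c) = ricci_ratio a b c"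
proof -
  have "(- b + - c) * (- c + - a) * (- a + - b) = - ((b + c) * (c + a) * (a + b))"
    by (simp add: algebra_simps)
  then have "ricci_ratio (- a) (- b) (- c) =
      2 * - a * - b * - c / - ((b + c) * (c + a) * (a + b))"
    by (simp only: ricci_ratio_def)
  then show ?thesis by (simp add: ricci_ratio_def)
qed

lemma pencil_coeff_neg: "pencil_coeff k (- a) (- b) (- c) = pencil_coeff k a b c"
  by (simp add: pencil_coeff_def algebra_simps)

text \<open>
  The strict inequality in the first case keeps one form from falling under both cases with the
  same \<open>k\<close>.
\<close>

definition pencil_semidefinite :: "real \<Rightarrow> real \<Rightarrow> real \<Rightarrow> bool" where
  "pencil_semidefinite a b c \<longleftrightarrow> (\<exists>k>0.
    (ricci_ratio a b c > - 2 \<longrightarrow>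
      pencil_coeff k a b c \<le> 0 \<and> pencil_coeff k b c a \<le> 0 \<and> pencil_coeff k c a b \<le> 0 \<and>
      (pencil_coeff k a b c < 0 \<or> pencil_coeff k b c a < 0 \<or> pencil_coeff k c a b < 0)) \<and>
    (ricci_ratio a b c \<le> - 2 \<longrightarrow>
      pencil_coeff k a b c \<ge> 0 \<and> pencil_coeff k b c a \<ge> 0 \<and> pencil_coeff k c a b \<ge> 0))"

lemma pencil_semidefinite_rotate: "pencil_semidefinite b c a = pencil_semidefinite a b c"
  unfolding pencil_semidefinite_def ricci_ratio_rotate[of b c a]
  by (simp only: conj_ac disj_ac)

text \<open>
  In the pattern \<open>b + c > 0\<close>, \<open>c + a > 0\<close>, \<open>a + b < 0\<close> a negative ratio forces \<open>a, b < 0 < c\<close>. Choose \<open>k\<close>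
  so that the third entry of the pencil vanishes. The other two entries are then negative multiples of
  \<open>a + b + c\<close>, and the ratio exceeds \<open>- 2\<close> exactly if \<open>a + b + c > 0\<close>.
\<close>

lemma pencil_semidefinite_if_ratio_negative:
  assumes nz: "(b + c) * (c + a) * (a + b) \<noteq> 0"
    and mixed: "\<not> (b + c > 0 \<and> c + a > 0 \<and> a + b > 0)" "\<not> (b + c < 0 \<and> c + a < 0 \<and> a + b < 0)"
    and w: "ricci_ratio a b c < 0"
  shows "pencil_semidefinite a b c"
proof -
  have "ricci_ratio a b c < 0 \<longrightarrow> pencil_semidefinite a b c"
  proof (rule mixed_signs_wlog[where P = "\<lambda>a b c. ricci_ratio a b c < 0 \<longrightarrow> pencil_semidefinite a b c",
        OF _ _ _ nz mixed])
    fix a b c :: real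
    show "ricci_ratio a b c < 0 \<longrightarrow> pencil_semidefinite a b c"
      if "ricci_ratio b c a < 0 \<longrightarrow> pencil_semidefinite b c a"
      using that by (simp only: ricci_ratio_rotate[of b c a] pencil_semidefinite_rotate[of b c a])
    show "ricci_ratio a b c < 0 \<longrightarrow> pencil_semidefinite a b c"
      if "ricci_ratio (- a) (- b) (- c) < 0 \<longrightarrow> pencil_semidefinite (- a) (- b) (- c)"
      using that unfolding pencil_semidefinite_def ricci_ratio_neg pencil_coeff_neg .
    assume l: "b + c > 0" "c + a > 0" "a + b < 0"
    show "ricci_ratio a b c < 0 \<longrightarrow> pencil_semidefinite a b c"
    proof
      assume neg: "ricci_ratio a b c < 0"
      have den: "(b + c) * (c + a) * (a + b) < 0" using l by (simp add: mult_pos_neg)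
      have c: "c > 0" using l by linarith
      have "2 * a * b * c > 0"
        using neg den unfolding ricci_ratio_def by (simp add: divide_less_0_iff)
      then have "a * b > 0" using c by (simp add: zero_less_mult_iff)
      then have ab: "a < 0" "b < 0" using l(3) by (auto simp: zero_less_mult_iff)
      define k where "k = a * b / ((b + c) * (c + a))"
      have k: "k > 0" using \<open>a * b > 0\<close> l by (simp add: k_def)
      have u3: "pencil_coeff k c a b = 0" using l by (simp add: pencil_coeff_def k_def)
      have "k * ((c + a) * (a + b)) = a * b * (a + b) / (b + c)"
        "k * ((a + b) * (b + c)) = a * b * (a + b) / (c + a)"
        using l by (simp_all add: k_def)
      then have u1: "pencil_coeff k a b c = b * (c - a) * (a + b + c) / (b + c)"
        and u2: "pencil_coeff k b c a = a * (c - b) * (a + b + c) / (c + a)"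
        using l unfolding pencil_coeff_def by (simp_all add: divide_simps) algebra+
      have "a * b < - (a + b) * c"
      proof -
        have "a * b + a * c < 0" "b * c < 0"
          using mult_neg_pos[OF ab(1) l(1)] mult_neg_pos[OF ab(2) c] by (simp_all add: algebra_simps)
        then show ?thesis by (simp add: algebra_simps)
      qed
      then have pos: "- (a + b) * c - a * b > 0" by simp
      have "ricci_ratio a b c + 2 =
          2 * (a * b * c + (b + c) * (c + a) * (a + b)) / ((b + c) * (c + a) * (a + b))"
        using den by (simp add: ricci_ratio_def field_simps)
      also have "a * b * c + (b + c) * (c + a) * (a + b) = - ((a + b + c) * (- (a + b) * c - a * b))"
        by algebra
      finally have "ricci_ratio a b c + 2 =
          (a + b + c) * (2 * (- (a + b) * c - a * b) / - ((b + c) * (c + a) * (a + b)))"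
        by simp
      moreover have "2 * (- (a + b) * c - a * b) / - ((b + c) * (c + a) * (a + b)) > 0"
        using pos den by (intro divide_pos_pos) auto
      ultimately have crit: "ricci_ratio a b c > - 2 \<longleftrightarrow> a + b + c > 0"
        by (smt (verit) mult_pos_pos mult_nonpos_nonneg)
      have f: "b * (c - a) / (b + c) < 0" "a * (c - b) / (c + a) < 0"
        using ab c l by (simp_all add: mult_neg_pos divide_neg_pos)
      have u12: "pencil_coeff k a b c = (a + b + c) * (b * (c - a) / (b + c))"
        "pencil_coeff k b c a = (a + b + c) * (a * (c - b) / (c + a))"
        unfolding u1 u2 by simp_all
      have "pencil_coeff k a b c < 0 \<and> pencil_coeff k b c a < 0" if "a + b + c > 0"
        unfolding u12 using that f by (simp only: mult_pos_neg)
      moreover have "pencil_coeff k a b c \<ge> 0 \<and> pencil_coeff k b c a \<ge> 0" if "a + b + c \<le> 0"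
        unfolding u12 using that f by (simp only: mult_nonpos_nonpos less_imp_le)
      ultimately show "pencil_semidefinite a b c"
        unfolding pencil_semidefinite_def
        using k u3 crit by (intro exI[of _ k]) (auto simp: not_less)
    qed
  qed
  with w show ?thesis by blast
qed

definition pencil_indefinite :: "real \<Rightarrow> real \<Rightarrow> real \<Rightarrow> bool" where
  "pencil_indefinite a b c \<longleftrightarrow> (\<forall>k>0.
    (pencil_coeff k a b c < 0 \<or> pencil_coeff k b c a < 0 \<or> pencil_coeff k c a b < 0) \<and>
    (pencil_coeff k a b c > 0 \<or> pencil_coeff k b c a > 0 \<or> pencil_coeff k c a b > 0))"

lemma pencil_indefinite_rotate: "pencil_indefinite b c a = pencil_indefinite a b c"
  unfolding pencil_indefinite_def by (simp only: conj_ac disj_ac)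

text \<open>
  In the pattern \<open>b + c > 0\<close>, \<open>c + a > 0\<close>, \<open>a + b < 0\<close> a positive ratio forces \<open>c > 0 > a b\<close>. Adding the
  Killing form makes the third entry more negative, and it increases the other two, one of which was
  already positive.
\<close>

lemma pencil_indefinite_if_ratio_positive:
  assumes nz: "(b + c) * (c + a) * (a + b) \<noteq> 0"
    and mixed: "\<not> (b + c > 0 \<and> c + a > 0 \<and> a + b > 0)" "\<not> (b + c < 0 \<and> c + a < 0 \<and> a + b < 0)"
    and w: "ricci_ratio a b c > 0"
  shows "pencil_indefinite a b c"
proof -
  have "ricci_ratio a b c > 0 \<longrightarrow> pencil_indefinite a b c"
  proof (rule mixed_signs_wlog[where P = "\<lambda>a b c. ricci_ratio a b c > 0 \<longrightarrow> pencil_indefinite a b c",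
        OF _ _ _ nz mixed])
    fix a b c :: real
    show "ricci_ratio a b c > 0 \<longrightarrow> pencil_indefinite a b c"
      if "ricci_ratio b c a > 0 \<longrightarrow> pencil_indefinite b c a"
      using that by (simp only: ricci_ratio_rotate[of b c a] pencil_indefinite_rotate[of b c a])
    show "ricci_ratio a b c > 0 \<longrightarrow> pencil_indefinite a b c"
      if "ricci_ratio (- a) (- b) (- c) > 0 \<longrightarrow> pencil_indefinite (- a) (- b) (- c)"
      using that unfolding pencil_indefinite_def ricci_ratio_neg pencil_coeff_neg .
    assume l: "b + c > 0" "c + a > 0" "a + b < 0"
    show "ricci_ratio a b c > 0 \<longrightarrow> pencil_indefinite a b c"
    proof
      assume pos: "ricci_ratio a b c > 0"
      have den: "(b + c) * (c + a) * (a + b) < 0" using l by (simp add: mult_pos_neg)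
      have c: "c > 0" using l by linarith
      have "2 * a * b * c < 0"
        using pos den unfolding ricci_ratio_def by (simp add: zero_less_divide_iff)
      then have ab: "a * b < 0" using c by (simp add: mult_less_0_iff)
      show "pencil_indefinite a b c"
        unfolding pencil_indefinite_def
      proof (intro allI impI conjI)
        fix k :: real assume k: "k > 0"
        have "k * ((b + c) * (c + a)) > 0" using k l by simp
        then show "pencil_coeff k a b c < 0 \<or> pencil_coeff k b c a < 0 \<or> pencil_coeff k c a b < 0"
          using ab by (simp add: pencil_coeff_def)
        have "k * ((c + a) * (a + b)) < 0" "k * ((a + b) * (b + c)) < 0"
          using k l by (simp_all add: mult_pos_neg mult_neg_pos)
        moreover have "b * c > 0 \<or> c * a > 0"
          using ab c by (auto simp: mult_less_0_iff)
        ultimately show "pencil_coeff k a b c > 0 \<or> pencil_coeff k b c a > 0 \<or> pencil_coeff k c a b > 0"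
          by (auto simp: pencil_coeff_def)
      qed
    qed
  qed
  with w show ?thesis by blast
qed

text \<open>
  Scaling the frame by \<open>a\<^sub>1, a\<^sub>2, a\<^sub>3\<close> replaces \<open>l\<^sub>3\<close> by \<open>l\<^sub>3 a\<^sub>1 a\<^sub>2 / a\<^sub>3\<close> and cyclically. The factors
  \<open>a\<^sub>i = \<plusminus> 2 / sqrt (l\<^sub>j l\<^sub>k)\<close> with the sign of the \<open>l\<^sub>i\<close> turn all constants into \<open>2\<close>.
\<close>

lemma SO3_if_same_signs:
  assumes f: "milnor_frame br e1 e2 e3 l1 l2 l3"
    and br: "lie_bracket br"
    and l: "l1 > 0 \<and> l2 > 0 \<and> l3 > 0 \<or> l1 < 0 \<and> l2 < 0 \<and> l3 < 0"
  shows "is_SO3 br"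
proof -
  have bb: "bilinear br" using br by (simp add: lie_bracket_def)
  note bbs = bilinear_lmul[OF bb] bilinear_rmul[OF bb]
  define a1 a2 a3 where "a1 = 2 * sgn l1 / sqrt (l2 * l3)" and "a2 = 2 * sgn l2 / sqrt (l3 * l1)"
    and "a3 = 2 * sgn l3 / sqrt (l1 * l2)"
  have prod: "a * b * l = 2 * c"
    if "a = 2 * sgn x / sqrt (y * l)" "b = 2 * sgn y / sqrt (l * x)" "c = 2 * sgn l / sqrt (x * y)"
      "x > 0 \<and> y > 0 \<and> l > 0 \<or> x < 0 \<and> y < 0 \<and> l < 0" for a b c x y l :: real
  proof -
    have "sqrt (y * l) * sqrt (l * x) = \<bar>l\<bar> * sqrt (x * y)"
      by (simp add: real_sqrt_mult)
    moreover have "a * b = 4 * (sgn x * sgn y) / (sqrt (y * l) * sqrt (l * x))"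
      by (simp add: that(1,2))
    moreover have "sgn x * sgn y = 1" using that(4) by auto
    ultimately have "a * b * l = 4 * (l / \<bar>l\<bar>) / sqrt (x * y)" by simp
    also have "l / \<bar>l\<bar> = sgn l" using that(4) by auto
    finally show ?thesis by (simp add: that(3))
  qed
  have nz: "a1 \<noteq> 0" "a2 \<noteq> 0" "a3 \<noteq> 0" using l by (auto simp: a1_def a2_def a3_def)
  have "basis3 (a1 *\<^sub>R e1) (a2 *\<^sub>R e2) (a3 *\<^sub>R e3)"
    using f nz by (intro basis3_scale) (auto simp: milnor_frame_def)
  moreover have "a1 * a2 * l3 = 2 * a3"
    by (rule prod[OF a1_def a2_def a3_def l])
  then have "br (a1 *\<^sub>R e1) (a2 *\<^sub>R e2) = 2 *\<^sub>R a3 *\<^sub>R e3"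
    using f by (simp add: milnor_frame_def bbs mult_ac)
  moreover have "a2 * a3 * l1 = 2 * a1"
    by (rule prod[OF a2_def a3_def a1_def]) (use l in blast)
  then have "br (a2 *\<^sub>R e2) (a3 *\<^sub>R e3) = 2 *\<^sub>R a1 *\<^sub>R e1"
    using f by (simp add: milnor_frame_def bbs mult_ac)
  moreover have "a3 * a1 * l2 = 2 * a2"
    by (rule prod[OF a3_def a1_def a2_def]) (use l in blast)
  then have "br (a3 *\<^sub>R e3) (a1 *\<^sub>R e1) = 2 *\<^sub>R a2 *\<^sub>R e2"
    using f by (simp add: milnor_frame_def bbs mult_ac)
  ultimately show ?thesis
    unfolding is_SO3_def has_structure_constants_def basis3_def by blast
qed

lemma signature_pmmI:
  assumes "basis3 a b c" "T a b = 0" "T a c = 0" "T b c = 0" "T a a > 0" "T b b < 0" "T c c < 0"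
  shows "signature_pmm T"
  using assms unfolding signature_pmm_def basis3_def by blast

text \<open>
  If all sums \<open>m\<^sub>j + m\<^sub>k\<close> have one sign, at most one \<open>m\<^sub>i\<close> can have the other sign, and a negative
  ratio says that one does. The entry \<open>2 m\<^sub>j m\<^sub>k\<close> not involving it is positive, the other two
  are negative.
\<close>

lemma signature_if_ratio_negative:
  assumes Q: "symmetric_form Q" and f: "ricci_frame br Q e1 e2 e3 m1 m2 m3"
    and l: "m2 + m3 > 0 \<and> m3 + m1 > 0 \<and> m1 + m2 > 0 \<or> m2 + m3 < 0 \<and> m3 + m1 < 0 \<and> m1 + m2 < 0"
    and w: "ricci_ratio m1 m2 m3 < 0"
  shows "signature_pmm Q"
proof -
  have sym: "Q x y = Q y x" for x y using Q by (simp add: symmetric_form_def)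
  have one: "signature_pmm Q"
    if f: "ricci_frame br Q e1 e2 e3 m1 m2 m3"
      and m: "m1 < 0 \<and> m2 > 0 \<and> m3 > 0 \<or> m1 > 0 \<and> m2 < 0 \<and> m3 < 0" for e1 e2 e3 m1 m2 m3
    using f m sym[of e1 e3]
    by (intro signature_pmmI[of e1 e2 e3])
      (auto simp: ricci_frame_def milnor_frame_def mult_pos_pos mult_neg_neg mult_pos_neg mult_neg_pos)
  note f2 = ricci_frame_rotate[OF f]
  note f3 = ricci_frame_rotate[OF f2]
  from l show ?thesis
  proof
    assume l: "m2 + m3 > 0 \<and> m3 + m1 > 0 \<and> m1 + m2 > 0"
    then have "(m2 + m3) * (m3 + m1) * (m1 + m2) > 0" by simp
    with w have "m1 * m2 * m3 < 0" by (simp add: ricci_ratio_def divide_less_0_iff)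
    then have "m1 < 0 \<and> m2 > 0 \<and> m3 > 0 \<or> m2 < 0 \<and> m3 > 0 \<and> m1 > 0 \<or> m3 < 0 \<and> m1 > 0 \<and> m2 > 0"
      using l by (auto simp: mult_less_0_iff zero_less_mult_iff)
    then show ?thesis using one[OF f] one[OF f2] one[OF f3] by blast
  next
    assume l: "m2 + m3 < 0 \<and> m3 + m1 < 0 \<and> m1 + m2 < 0"
    then have "(m2 + m3) * (m3 + m1) * (m1 + m2) < 0" by (simp add: mult_neg_neg mult_pos_neg)
    with w have "m1 * m2 * m3 > 0" by (simp add: ricci_ratio_def divide_less_0_iff)
    then have "m1 > 0 \<and> m2 < 0 \<and> m3 < 0 \<or> m2 > 0 \<and> m3 < 0 \<and> m1 < 0 \<or> m3 > 0 \<and> m1 < 0 \<and> m2 < 0"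
      using l by (auto simp: mult_less_0_iff zero_less_mult_iff)
    then show ?thesis using one[OF f] one[OF f2] one[OF f3] by blast
  qed
qed

section \<open>Two metrics with proportional Ricci forms\<close>

lemma symmetric_form_scale:
  assumes "symmetric_form T"
  shows "symmetric_form (\<lambda>x y. c * T x y)"
proof -
  have b: "bilinear T" and s: "T x y = T y x" for x y
    using assms by (auto simp: symmetric_form_def)
  note bs = bilinear_ladd[OF b] bilinear_radd[OF b] bilinear_lmul[OF b] bilinear_rmul[OF b]
  have "bilinear (\<lambda>x y. c * T x y)"
    unfolding bilinear_def by (auto intro!: linearI simp: bs algebra_simps)
  then show ?thesis using s by (simp add: symmetric_form_def)
qed

lemma symmetric_form_nonzero_diagonal:
  assumes T: "symmetric_form T" and "T \<noteq> (\<lambda>x y. 0)"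
  obtains x where "T x x \<noteq> 0"
proof -
  have b: "bilinear T" and s: "T x y = T y x" for x y
    using T by (auto simp: symmetric_form_def)
  obtain x y where xy: "T x y \<noteq> 0" using assms(2) by (meson ext)
  have "T (x + y) (x + y) = T x x + 2 * T x y + T y y"
    using s[of y x] by (simp add: bilinear_ladd[OF b] bilinear_radd[OF b])
  with xy have "T (x + y) (x + y) \<noteq> 0 \<or> T x x \<noteq> 0 \<or> T y y \<noteq> 0" by linarith
  with that show thesis by blast
qed

lemma ricci_frame_pencil:
  fixes br :: "'v::real_vector \<Rightarrow> 'v \<Rightarrow> 'v"
  assumes d: "dim (UNIV :: 'v set) = 3" and br: "lie_bracket br" and T: "symmetric_form T"
    and f: "ricci_frame br (\<lambda>x y. c * T x y) e1 e2 e3 a b m"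
  shows "\<exists>x1 x2 x3. \<forall>k. c * T x x + k * killing br x x =
      2 * (pencil_coeff k a b m * x1\<^sup>2 + pencil_coeff k b m a * x2\<^sup>2 + pencil_coeff k m a b * x3\<^sup>2)"
    and "c * T e1 e1 + k * killing br e1 e1 = 2 * pencil_coeff k a b m"
    and "c * T e2 e2 + k * killing br e2 e2 = 2 * pencil_coeff k b m a"
    and "c * T e3 e3 + k * killing br e3 e3 = 2 * pencil_coeff k m a b"
proof -
  note q = ricci_frame_quadratic[OF d br symmetric_form_scale[OF T] f]
  have "basis3 e1 e2 e3" using f by (simp add: ricci_frame_def milnor_frame_def)
  then obtain x1 x2 x3 where "x = x1 *\<^sub>R e1 + x2 *\<^sub>R e2 + x3 *\<^sub>R e3" by (rule basis3_expand)
  from q[OF this]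
  show "\<exists>x1 x2 x3. \<forall>k. c * T x x + k * killing br x x =
      2 * (pencil_coeff k a b m * x1\<^sup>2 + pencil_coeff k b m a * x2\<^sup>2 + pencil_coeff k m a b * x3\<^sup>2)"
    by blast
  show "c * T e1 e1 + k * killing br e1 e1 = 2 * pencil_coeff k a b m"
    using q[of e1 1 0 0 k] by simp
  show "c * T e2 e2 + k * killing br e2 e2 = 2 * pencil_coeff k b m a"
    using q[of e2 0 1 0 k] by simp
  show "c * T e3 e3 + k * killing br e3 e3 = 2 * pencil_coeff k m a b"
    using q[of e3 0 0 1 k] by simp
qed

lemma killing_indefinite_iff_mixed:
  fixes br :: "'v::real_vector \<Rightarrow> 'v \<Rightarrow> 'v"
  assumes d: "dim (UNIV :: 'v set) = 3" and br: "lie_bracket br"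
    and f: "milnor_frame br e1 e2 e3 l1 l2 l3" and nz: "l1 * l2 * l3 \<noteq> 0"
  defines "same \<equiv> l1 > 0 \<and> l2 > 0 \<and> l3 > 0 \<or> l1 < 0 \<and> l2 < 0 \<and> l3 < 0"
  shows "same \<Longrightarrow> killing br x x \<le> 0"
    and "\<not> same \<Longrightarrow> \<exists>x y. killing br x x > 0 \<and> killing br y y < 0"
proof -
  note K = killing_milnor_frame[OF d br f]
  assume same
  then have "l2 * l3 > 0" "l3 * l1 > 0" "l1 * l2 > 0"
    by (auto simp: same_def mult_pos_pos mult_neg_neg)
  moreover have "basis3 e1 e2 e3" using f by (simp add: milnor_frame_def)
  then obtain x1 x2 x3 where "x = x1 *\<^sub>R e1 + x2 *\<^sub>R e2 + x3 *\<^sub>R e3" by (rule basis3_expand)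
  ultimately show "killing br x x \<le> 0"
    by (subst K) (simp_all add: add_nonneg_nonneg mult_nonneg_nonneg del: minus_add_distrib)
next
  note K = killing_milnor_frame[OF d br f]
  have e: "killing br e1 e1 = - 2 * (l2 * l3)" "killing br e2 e2 = - 2 * (l3 * l1)"
    "killing br e3 e3 = - 2 * (l1 * l2)"
    using K[of e1 1 0 0] K[of e2 0 1 0] K[of e3 0 0 1] by simp_all
  assume "\<not> same"
  moreover have "l1 < 0 \<or> l1 > 0" "l2 < 0 \<or> l2 > 0" "l3 < 0 \<or> l3 > 0"
    using nz by (auto simp: neq_iff)
  ultimately have "(l2 * l3 < 0 \<or> l3 * l1 < 0 \<or> l1 * l2 < 0) \<and> (l2 * l3 > 0 \<or> l3 * l1 > 0 \<or> l1 * l2 > 0)"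
    unfolding same_def by (auto simp: mult_less_0_iff zero_less_mult_iff)
  then have "(killing br e1 e1 > 0 \<or> killing br e2 e2 > 0 \<or> killing br e3 e3 > 0) \<and>
      (killing br e1 e1 < 0 \<or> killing br e2 e2 < 0 \<or> killing br e3 e3 < 0)"
    unfolding e by (auto simp: mult.commute[of l3 l1])
  then show "\<exists>x y. killing br x x > 0 \<and> killing br y y < 0" by blast
qed

lemma signature_pmm_scale:
  assumes "c > 0" "signature_pmm (\<lambda>x y. c * T x y)"
  shows "signature_pmm T"
  using assms unfolding signature_pmm_def by (auto simp: zero_less_mult_iff mult_less_0_iff)

text \<open>
  Structure constants of one sign would make the group \<open>SO(3)\<close> and give \<open>T\<close> the signature
  \<open>(+,-,-)\<close>; hence the signs are mixed, and the analysis of the coefficients applies.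
\<close>

lemma pencil_semidefinite_form:
  fixes br :: "'v::real_vector \<Rightarrow> 'v \<Rightarrow> 'v"
  assumes d: "dim (UNIV :: 'v set) = 3" and br: "lie_bracket br" and T: "symmetric_form T"
    and ex: "\<not> (signature_pmm T \<and> is_SO3 br)" and c: "c > 0"
    and f: "ricci_frame br (\<lambda>x y. c * T x y) e1 e2 e3 a b m"
    and nz: "(b + m) * (m + a) * (a + b) \<noteq> 0" and w: "ricci_ratio a b m < 0"
  obtains k where "k > 0" "\<exists>x y. killing br x x > 0 \<and> killing br y y < 0"
    "ricci_ratio a b m > - 2 \<Longrightarrow> (\<forall>x. T x x + k * killing br x x \<le> 0) \<and> (\<exists>x. T x x + k * killing br x x < 0)"
    "ricci_ratio a b m \<le> - 2 \<Longrightarrow> \<forall>x. T x x + k * killing br x x \<ge> 0"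
proof -
  have M: "milnor_frame br e1 e2 e3 (b + m) (m + a) (a + b)"
    using f by (simp add: ricci_frame_def)
  note pencil = ricci_frame_pencil[OF d br T f]
  have mixed: "\<not> (b + m > 0 \<and> m + a > 0 \<and> a + b > 0 \<or> b + m < 0 \<and> m + a < 0 \<and> a + b < 0)"
  proof
    assume l: "b + m > 0 \<and> m + a > 0 \<and> a + b > 0 \<or> b + m < 0 \<and> m + a < 0 \<and> a + b < 0"
    have "signature_pmm T"
      using signature_if_ratio_negative[OF symmetric_form_scale[OF T] f l w] c
      by (rule signature_pmm_scale[rotated])
    with SO3_if_same_signs[OF M br l] ex show False by blast
  qed
  have "pencil_semidefinite a b m"
    by (rule pencil_semidefinite_if_ratio_negative[OF nz _ _ w]) (use mixed in blast)+
  then obtain k where k: "k > 0"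
    and le: "ricci_ratio a b m > - 2 \<Longrightarrow>
      pencil_coeff k a b m \<le> 0 \<and> pencil_coeff k b m a \<le> 0 \<and> pencil_coeff k m a b \<le> 0 \<and>
      (pencil_coeff k a b m < 0 \<or> pencil_coeff k b m a < 0 \<or> pencil_coeff k m a b < 0)"
    and ge: "ricci_ratio a b m \<le> - 2 \<Longrightarrow>
      pencil_coeff k a b m \<ge> 0 \<and> pencil_coeff k b m a \<ge> 0 \<and> pencil_coeff k m a b \<ge> 0"
    unfolding pencil_semidefinite_def by blast
  have scale: "c * (T x x + k / c * killing br x x) = c * T x x + k * killing br x x" for x
    using c by (simp add: field_simps)
  have sgn: "T x x + k / c * killing br x x \<le> 0 \<longleftrightarrow> c * T x x + k * killing br x x \<le> 0"
    "T x x + k / c * killing br x x < 0 \<longleftrightarrow> c * T x x + k * killing br x x < 0"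
    "T x x + k / c * killing br x x \<ge> 0 \<longleftrightarrow> c * T x x + k * killing br x x \<ge> 0" for x
    unfolding scale[symmetric] using c by (simp_all add: mult_le_0_iff mult_less_0_iff zero_le_mult_iff)
  show thesis
  proof
    show "k / c > 0" using k c by simp
    show "\<exists>x y. killing br x x > 0 \<and> killing br y y < 0"
      using killing_indefinite_iff_mixed(2)[OF d br M nz mixed] .
  next
    assume "ricci_ratio a b m > - 2"
    note le = le[OF this]
    have "c * T x x + k * killing br x x \<le> 0" for x
    proof -
      obtain x1 x2 x3 where "c * T x x + k * killing br x x =
          2 * (pencil_coeff k a b m * x1\<^sup>2 + pencil_coeff k b m a * x2\<^sup>2 + pencil_coeff k m a b * x3\<^sup>2)"
        using pencil(1) by blast
      moreover have "pencil_coeff k a b m * x1\<^sup>2 \<le> 0" "pencil_coeff k b m a * x2\<^sup>2 \<le> 0"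
        "pencil_coeff k m a b * x3\<^sup>2 \<le> 0"
        using le by (simp_all add: mult_nonpos_nonneg)
      ultimately show ?thesis by simp
    qed
    moreover have "\<exists>x. c * T x x + k * killing br x x < 0"
      using le pencil(2-4)[of k] by (metis mult_pos_neg zero_less_numeral)
    ultimately show "(\<forall>x. T x x + k / c * killing br x x \<le> 0) \<and> (\<exists>x. T x x + k / c * killing br x x < 0)"
      unfolding sgn by blast
  next
    assume "ricci_ratio a b m \<le> - 2"
    note ge = ge[OF this]
    have "c * T x x + k * killing br x x \<ge> 0" for x
    proof -
      obtain x1 x2 x3 where "c * T x x + k * killing br x x =
          2 * (pencil_coeff k a b m * x1\<^sup>2 + pencil_coeff k b m a * x2\<^sup>2 + pencil_coeff k m a b * x3\<^sup>2)"
        using pencil(1) by blast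
      then show ?thesis using ge by simp
    qed
    then show "\<forall>x. T x x + k / c * killing br x x \<ge> 0" unfolding sgn by blast
  qed
qed

text \<open>
  Here mixed signs are expressed by a vector on which the Killing form is positive, because this
  condition can be transferred from one frame to another.
\<close>

lemma pencil_indefinite_form:
  fixes br :: "'v::real_vector \<Rightarrow> 'v \<Rightarrow> 'v"
  assumes d: "dim (UNIV :: 'v set) = 3" and br: "lie_bracket br" and T: "symmetric_form T"
    and c: "c > 0"
    and f: "ricci_frame br (\<lambda>x y. c * T x y) e1 e2 e3 a b m"
    and nz: "(b + m) * (m + a) * (a + b) \<noteq> 0" and w: "ricci_ratio a b m > 0"
    and K: "killing br z z > 0" and k: "k > 0"
  shows "\<exists>x y. T x x + k * killing br x x > 0 \<and> T y y + k * killing br y y < 0"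
proof -
  have M: "milnor_frame br e1 e2 e3 (b + m) (m + a) (a + b)"
    using f by (simp add: ricci_frame_def)
  note pencil = ricci_frame_pencil[OF d br T f]
  have mixed: "\<not> (b + m > 0 \<and> m + a > 0 \<and> a + b > 0 \<or> b + m < 0 \<and> m + a < 0 \<and> a + b < 0)"
    using killing_indefinite_iff_mixed(1)[OF d br M nz, of z] K by linarith
  have "pencil_indefinite a b m"
    by (rule pencil_indefinite_if_ratio_positive[OF nz _ _ w]) (use mixed in blast)+
  then have "(pencil_coeff (c * k) a b m < 0 \<or> pencil_coeff (c * k) b m a < 0 \<or> pencil_coeff (c * k) m a b < 0) \<and>
    (pencil_coeff (c * k) a b m > 0 \<or> pencil_coeff (c * k) b m a > 0 \<or> pencil_coeff (c * k) m a b > 0)"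
    using c k unfolding pencil_indefinite_def by simp
  then have "\<exists>x y. c * T x x + (c * k) * killing br x x > 0 \<and> c * T y y + (c * k) * killing br y y < 0"
    using pencil(2-4)[of "c * k"] by (metis mult_pos_neg mult_pos_pos zero_less_numeral)
  moreover have "c * T x x + (c * k) * killing br x x = c * (T x x + k * killing br x x)" for x
    by (simp add: algebra_simps)
  ultimately show ?thesis
    using c by (simp add: zero_less_mult_iff mult_less_0_iff)
qed

text \<open>
  The first frame provides a semidefinite member \<open>T + k B\<close> with \<open>k > 0\<close>, and the second one makes every
  such member indefinite.
\<close>

lemma ricci_ratio_no_sign_change:
  fixes br :: "'v::real_vector \<Rightarrow> 'v \<Rightarrow> 'v"
  assumes d: "dim (UNIV :: 'v set) = 3" and br: "lie_bracket br" and T: "symmetric_form T"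
    and ex: "\<not> (signature_pmm T \<and> is_SO3 br)" and c: "c > 0" "c' > 0"
    and e: "ricci_frame br (\<lambda>x y. c * T x y) e1 e2 e3 a b m"
    and f: "ricci_frame br (\<lambda>x y. c' * T x y) f1 f2 f3 a' b' m'"
    and nz: "(b + m) * (m + a) * (a + b) \<noteq> 0" "(b' + m') * (m' + a') * (a' + b') \<noteq> 0"
  shows "\<not> (ricci_ratio a b m < 0 \<and> ricci_ratio a' b' m' > 0)"
proof
  assume r: "ricci_ratio a b m < 0 \<and> ricci_ratio a' b' m' > 0"
  obtain k where k: "k > 0" "\<exists>x y. killing br x x > 0 \<and> killing br y y < 0"
    and s: "ricci_ratio a b m > - 2 \<Longrightarrow>
        (\<forall>x. T x x + k * killing br x x \<le> 0) \<and> (\<exists>x. T x x + k * killing br x x < 0)"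
      "ricci_ratio a b m \<le> - 2 \<Longrightarrow> \<forall>x. T x x + k * killing br x x \<ge> 0"
    using pencil_semidefinite_form[OF d br T ex c(1) e nz(1)] r by blast
  obtain x y where "T x x + k * killing br x x > 0" "T y y + k * killing br y y < 0"
    using pencil_indefinite_form[OF d br T c(2) f nz(2) _ _ k(1)] r k(2) by blast
  with s show False by (meson not_le)
qed

text \<open>
  A negative semidefinite member \<open>T + k B\<close> and a positive semidefinite member \<open>T + k' B\<close> make
  \<open>(k' - k) B\<close> positive semidefinite. As \<open>B\<close> is indefinite, \<open>k = k'\<close>, so that the member vanishes.
\<close>

lemma ricci_ratio_no_crossing:
  fixes br :: "'v::real_vector \<Rightarrow> 'v \<Rightarrow> 'v"
  assumes d: "dim (UNIV :: 'v set) = 3" and br: "lie_bracket br" and T: "symmetric_form T"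
    and ex: "\<not> (signature_pmm T \<and> is_SO3 br)" and c: "c > 0" "c' > 0"
    and e: "ricci_frame br (\<lambda>x y. c * T x y) e1 e2 e3 a b m"
    and f: "ricci_frame br (\<lambda>x y. c' * T x y) f1 f2 f3 a' b' m'"
    and nz: "(b + m) * (m + a) * (a + b) \<noteq> 0" "(b' + m') * (m' + a') * (a' + b') \<noteq> 0"
  shows "\<not> (- 2 < ricci_ratio a b m \<and> ricci_ratio a b m < 0 \<and> ricci_ratio a' b' m' \<le> - 2)"
proof
  assume r: "- 2 < ricci_ratio a b m \<and> ricci_ratio a b m < 0 \<and> ricci_ratio a' b' m' \<le> - 2"
  obtain k z where k: "\<exists>x y. killing br x x > 0 \<and> killing br y y < 0"
    and le: "\<And>x. T x x + k * killing br x x \<le> 0" and z: "T z z + k * killing br z z < 0"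
    using pencil_semidefinite_form[OF d br T ex c(1) e nz(1)] r by metis
  have "ricci_ratio a' b' m' < 0" using r by linarith
  then obtain k' where ge: "\<And>x. T x x + k' * killing br x x \<ge> 0"
    using pencil_semidefinite_form[OF d br T ex c(2) f nz(2)] r by metis
  obtain x y where x: "killing br x x > 0" and y: "killing br y y < 0" using k by blast
  have "k * killing br x x \<le> k' * killing br x x" "k * killing br y y \<le> k' * killing br y y"
    using le[of x] ge[of x] le[of y] ge[of y] by linarith+
  with x y have "k = k'" by simp
  with z ge[of z] show False by simp
qed

section \<open>Uniqueness of the scale\<close>

lemma degenerate_pencil:
  fixes a b c :: real
  assumes "(b + c) * (c + a) * (a + b) = 0" "a * b * c = 0"
  shows "\<exists>k\<in>{0, 1}. pencil_coeff k a b c = 0 \<and> pencil_coeff k b c a = 0 \<and> pencil_coeff k c a b = 0"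
proof -
  consider "c = - b" | "a = - c" | "b = - a"
    using assms(1) by (auto simp: eq_neg_iff_add_eq_0 add.commute)
  then show ?thesis
    by cases (use assms(2) in \<open>auto simp: pencil_coeff_def algebra_simps\<close>)
qed

text \<open>
  A vanishing structure constant \<open>a + b = 0\<close> together with \<open>a b m = 0\<close> leaves two possibilities. Either
  \<open>a = b = 0\<close> and the Ricci form vanishes, which \<open>T \<noteq> 0\<close> rules out, or \<open>m = 0\<close> and the Ricci form is the
  negative of the Killing form.
\<close>

lemma degenerate_ricci_form_eq_killing:
  fixes br :: "'v::real_vector \<Rightarrow> 'v \<Rightarrow> 'v"
  assumes d: "dim (UNIV :: 'v set) = 3" and br: "lie_bracket br" and T: "symmetric_form T"
    and nonzero: "T \<noteq> (\<lambda>x y. 0)" and c: "c > 0"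
    and f: "ricci_frame br (\<lambda>x y. c * T x y) e1 e2 e3 a b m"
    and degenerate: "(b + m) * (m + a) * (a + b) = 0" "a * b * m = 0"
  shows "c * T x x = - killing br x x"
proof -
  obtain k where k: "k \<in> {0, 1}"
    and 0: "pencil_coeff k a b m = 0" "pencil_coeff k b m a = 0" "pencil_coeff k m a b = 0"
    using degenerate_pencil[OF degenerate] by blast
  have z: "c * T x x + k * killing br x x = 0" for x
    using ricci_frame_pencil(1)[OF d br T f, of x] 0
    by (metis add_0 mult_zero_left mult_zero_right)
  obtain y where "T y y \<noteq> 0" using symmetric_form_nonzero_diagonal[OF T nonzero] .
  with z[of y] c k have "k = 1" by auto
  with z[of x] show ?thesis by simp
qed

lemma ricci_frame_identities:
  fixes a b m c :: real
  assumes f: "ricci_frame br (\<lambda>x y. c * T x y) e1 e2 e3 a b m"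
  defines "P \<equiv> (b + m) * (m + a) * (a + b)"
  shows "2 * P - c * ((b + m) * T e1 e1 + (m + a) * T e2 e2 + (a + b) * T e3 e3) = 2 * (2 * a * b * m)"
    and "2 * (2 * a * b * m)\<^sup>2 = c ^ 3 * (T e1 e1 * T e2 e2 * T e3 e3)"
proof -
  have r: "c * T e1 e1 = 2 * b * m" "c * T e2 e2 = 2 * m * a" "c * T e3 e3 = 2 * a * b"
    using f by (simp_all add: ricci_frame_def)
  show "2 * P - c * ((b + m) * T e1 e1 + (m + a) * T e2 e2 + (a + b) * T e3 e3) = 2 * (2 * a * b * m)"
    unfolding P_def using r by algebra
  show "2 * (2 * a * b * m)\<^sup>2 = c ^ 3 * (T e1 e1 * T e2 e2 * T e3 e3)"
    using r by algebra
qed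

text \<open>
  The quantities \<open>P\<close>, \<open>t\<close>, \<open>D\<close> of the two frames differ by the factors \<open>\<delta>\<close>, \<open>\<delta>\<close>, \<open>\<delta>\<^sup>2\<close>, which cancel in the
  equation for the scale.
\<close>

lemma ricci_frame_scale_unique:
  fixes br :: "'v::real_vector \<Rightarrow> 'v \<Rightarrow> 'v"
  assumes d: "dim (UNIV :: 'v set) = 3" and br: "lie_bracket br" and T: "symmetric_form T"
    and nonzero: "T \<noteq> (\<lambda>x y. 0)" and ex: "\<not> (signature_pmm T \<and> is_SO3 br)"
    and c: "c > 0" "c' > 0"
    and e: "ricci_frame br (\<lambda>x y. c * T x y) e1 e2 e3 a1 a2 a3"
    and f: "ricci_frame br (\<lambda>x y. c' * T x y) f1 f2 f3 b1 b2 b3"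
  shows "c = c'"
proof -
  define P where "P = (a2 + a3) * (a3 + a1) * (a1 + a2)"
  define t where "t = (a2 + a3) * T e1 e1 + (a3 + a1) * T e2 e2 + (a1 + a2) * T e3 e3"
  define D where "D = T e1 e1 * T e2 e2 * T e3 e3"
  have Me: "milnor_frame br e1 e2 e3 (a2 + a3) (a3 + a1) (a1 + a2)"
      "T e1 e2 = 0" "T e2 e3 = 0" "T e3 e1 = 0"
    and Mf: "milnor_frame br f1 f2 f3 (b2 + b3) (b3 + b1) (b1 + b2)"
      "T f1 f2 = 0" "T f2 f3 = 0" "T f3 f1 = 0"
    using e f c by (simp_all add: ricci_frame_def)
  obtain \<delta> where \<delta>: "\<delta> \<noteq> 0" and P': "(b2 + b3) * (b3 + b1) * (b1 + b2) = \<delta> * P"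
    and t': "(b2 + b3) * T f1 f1 + (b3 + b1) * T f2 f2 + (b1 + b2) * T f3 f3 = \<delta> * t"
    and D': "T f1 f1 * T f2 f2 * T f3 f3 = \<delta>\<^sup>2 * D"
    unfolding P_def t_def D_def by (rule milnor_frame_change[OF br T Me Mf])
  define q q' where "q = 2 * a1 * a2 * a3" and "q' = 2 * b1 * b2 * b3"
  have i: "2 * P - c * t = 2 * q" "2 * q\<^sup>2 = c ^ 3 * D"
    using ricci_frame_identities[OF e] by (simp_all only: P_def t_def D_def q_def)
  have i': "2 * (\<delta> * P) - c' * (\<delta> * t) = 2 * q'" "2 * q'\<^sup>2 = c' ^ 3 * (\<delta>\<^sup>2 * D)"
    using ricci_frame_identities[OF f] by (simp_all only: P' t' D' q'_def)
  consider "P = 0" "D = 0" | "P = 0" "D \<noteq> 0" | "P \<noteq> 0" by blast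
  then show ?thesis
  proof cases
    case 1
    obtain y where y: "T y y \<noteq> 0" using symmetric_form_nonzero_diagonal[OF T nonzero] .
    have "a1 * a2 * a3 = 0" "b1 * b2 * b3 = 0" using i(2) i'(2) 1 by (simp_all add: q_def q'_def)
    with 1 have "c * T y y = - killing br y y" "c' * T y y = - killing br y y"
      using degenerate_ricci_form_eq_killing[OF d br T nonzero c(1) e]
        degenerate_ricci_form_eq_killing[OF d br T nonzero c(2) f] P' by (simp_all add: P_def)
    with y show ?thesis by (metis mult_right_cancel)
  next
    case 2
    have "c\<^sup>2 * (t\<^sup>2 - 2 * c * D) = 0" using i 2(1) by algebra
    moreover have "\<delta>\<^sup>2 * (c'\<^sup>2 * (t\<^sup>2 - 2 * c' * D)) = 0" using i' 2(1) by algebra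
    ultimately have "t\<^sup>2 = 2 * c * D" "t\<^sup>2 = 2 * c' * D" using c \<delta> by simp_all
    with 2(2) show ?thesis by simp
  next
    case 3
    define \<theta> E where "\<theta> = t / (2 * P)" and "E = D / (8 * P\<^sup>2)"
    define w w' where "w = ricci_ratio a1 a2 a3" and "w' = ricci_ratio b1 b2 b3"
    have nz: "(a2 + a3) * (a3 + a1) * (a1 + a2) \<noteq> 0" "(b2 + b3) * (b3 + b1) * (b1 + b2) \<noteq> 0"
      using 3 \<delta> P' by (simp_all add: P_def)
    have wq: "w = q / P" "w' = q' / (\<delta> * P)"
      unfolding w_def w'_def ricci_ratio_def q_def q'_def P' by (simp_all only: P_def)
    have "q = P - c * t / 2" "q' = \<delta> * (P - c' * t / 2)"
      using i(1) i'(1) by (simp_all add: algebra_simps)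
    then have w: "w = 1 - c * \<theta>" "w' = 1 - c' * \<theta>"
      using 3 \<delta> by (simp_all add: wq \<theta>_def diff_divide_distrib)
    have sq: "w\<^sup>2 = 4 * c ^ 3 * E" "w'\<^sup>2 = 4 * c' ^ 3 * E"
      using i(2) i'(2) 3 \<delta> by (simp_all add: wq E_def power_divide field_simps power_mult_distrib)
    have "w\<^sup>2 = 0 \<longleftrightarrow> w'\<^sup>2 = 0" unfolding sq using c by simp
    then have "w = 0 \<longleftrightarrow> w' = 0" by simp
    moreover have "\<not> (w < 0 \<and> w' > 0)" "\<not> (w' < 0 \<and> w > 0)"
      using ricci_ratio_no_sign_change[OF d br T ex c e f nz]
        ricci_ratio_no_sign_change[OF d br T ex c(2,1) f e nz(2,1)]
      by (simp_all add: w_def w'_def)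
    ultimately have sgn: "sgn w = sgn w'" by (auto simp: sgn_if)
    have "\<not> (- 2 < w \<and> w < 0 \<and> w' \<le> - 2)" "\<not> (- 2 < w' \<and> w' < 0 \<and> w \<le> - 2)"
      using ricci_ratio_no_crossing[OF d br T ex c e f nz]
        ricci_ratio_no_crossing[OF d br T ex c(2,1) f e nz(2,1)]
      by (simp_all add: w_def w'_def)
    moreover have "w < 0 \<longleftrightarrow> w' < 0" using sgn by (metis sgn_less)
    ultimately have "- 2 \<le> w \<and> - 2 \<le> w' \<or> w \<le> - 2 \<and> w' \<le> - 2" by linarith
    with sq sgn show ?thesis unfolding w by (intro scale_unique[OF c])
  qed
qed

theorem theorem2p4:
  fixes br :: "'v::real_vector \<Rightarrow> 'v \<Rightarrow> 'v" and T :: "'v \<Rightarrow> 'v \<Rightarrow> real"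
  assumes "dim (UNIV :: 'v set) = 3" and "lie_bracket br" and "unimodular br"
    and "symmetric_form T"
    and "\<not> (T = (\<lambda>x y. 0) \<or> (signature_pmm T \<and> is_SO3 br))"
  shows "\<exists>\<^sub>\<le>\<^sub>1 c::real. c > 0 \<and> (\<exists>g. metric_form g \<and> (\<forall>x y. Ric br g x y = c * T x y))"
proof (rule Uniq_I)
  have frame: "\<exists>e1 e2 e3 a b m. ricci_frame br (\<lambda>x y. c * T x y) e1 e2 e3 a b m"
    if sol: "\<exists>g. metric_form g \<and> (\<forall>x y. Ric br g x y = c * T x y)" for c
  proof -
    obtain g where g: "metric_form g" and "\<forall>x y. Ric br g x y = c * T x y" using sol by blast
    then have "Ric br g = (\<lambda>x y. c * T x y)" by (intro ext) blast
    with ex_ricci_frame[OF assms(1-3) g] show ?thesis by metis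
  qed
  fix c c' :: real
  assume "c > 0 \<and> (\<exists>g. metric_form g \<and> (\<forall>x y. Ric br g x y = c * T x y))"
    and "c' > 0 \<and> (\<exists>g. metric_form g \<and> (\<forall>x y. Ric br g x y = c' * T x y))"
  then show "c = c'"
    using frame[of c] frame[of c'] ricci_frame_scale_unique[OF assms(1,2,4)] assms(5) by metis
qed

end
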